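(* A simplicial set $X$ is a quasi-2-Segal set if and only if the maps $$\mathrm{Map}(\Delta[3],X)\to \mathrm{Map}(\Lambda^{0,2}[3],X)\quad\text{and}\quad \mathrm{Map}(\Delta[3],X)\to \mathrm{Map}(\Lambda^{1,3}[3],X)$$ induced by the inclusions $\Lambda^{0,2}[3]\hookrightarrow\Delta[3]$ and $\Lambda^{1,3}[3]\hookrightarrow\Delta[3]$ are both trivial fibrations.
   Context: $\Delta[n]$ is the standard $n$-simplex and $d_\ell\Delta[n]$ is its face opposite the vertex $\ell$. For $n\geq 3$, a subset $S\subseteq\{0,\ldots,n\}$ is broken if there exist $0\leq i<j<k<\ell\leq n$ such that either $i,k\in S$ and $j,\ell\notin S$, or $i,k\notin S$ and $j,\ell\in S$. For $n\ge 3$ and a broken two-element subset $\{i,j\}\subseteq\{0,\ldots,n\}$, the 2-Segal horn $\Lambda^{i,j}[n]\subseteq\Delta[n]$ is the union of all faces $d_\ell\Delta[n]$ with $\ell\neq i,j$. A simplicial set $X$ is a quasi-2-Segal set if every map $\Lambda^{i,j}[n]\to X$ from a 2-Segal horn extends along the inclusion $\Lambda^{i,j}[n]\hookrightarrow\Delta[n]$ to a map $\Delta[n]\to X$. $\mathrm{Map}(A,X)$ is the simplicial set with $n$-simplices $\mathrm{Hom}(A\times\Delta[n],X)$. A trivial fibration is a map of simplicial sets with the right lifting property with respect to all boundary inclusions $\partial\Delta[n]\hookrightarrow\Delta[n]$, $n\geq 0$. *)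

theory Defs
  imports Main "HOL-Library.FuncSet"
begin

text \<open>
  Morphisms \<open>[m] \<rightarrow> [n]\<close> of the simplex category, where \<open>[n] = {0, \<dots>, n}\<close>. They are kept
  extensional, so that equality of HOL functions is equality of morphisms with source \<open>[m]\<close>.
\<close>

definition ord_maps :: "nat \<Rightarrow> nat \<Rightarrow> (nat \<Rightarrow> nat) set" where
  "ord_maps m n = {\<theta> \<in> {..m} \<rightarrow>\<^sub>E {..n}. mono_on {..m} \<theta>}"

text \<open>
  For \<open>\<theta> : [m] \<rightarrow> [n]\<close>, the function \<open>act X m n \<theta>\<close> is \<open>X(\<theta>) : X\<^sub>n \<rightarrow> X\<^sub>m\<close>. The indices \<open>m\<close>, \<open>n\<close> are
  explicit because \<open>\<theta>\<close> does not determine its codomain and the sets \<open>cells X n\<close> may overlap.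
\<close>

record 'a sset =
  cells :: "nat \<Rightarrow> 'a set"
  act :: "nat \<Rightarrow> nat \<Rightarrow> (nat \<Rightarrow> nat) \<Rightarrow> 'a \<Rightarrow> 'a"

locale simplicial_set =
  fixes X :: "'a sset"
  assumes act_closed:
      "\<theta> \<in> ord_maps m n \<Longrightarrow> x \<in> cells X n \<Longrightarrow> act X m n \<theta> x \<in> cells X m"
    and act_id:
      "x \<in> cells X n \<Longrightarrow> act X n n (\<lambda>i\<in>{..n}. i) x = x"
    and act_comp:
      "\<theta> \<in> ord_maps l m \<Longrightarrow> \<phi> \<in> ord_maps m n \<Longrightarrow> x \<in> cells X n \<Longrightarrow>
        act X l n (compose {..l} \<phi> \<theta>) x = act X l m \<theta> (act X m n \<phi> x)"

text \<open>
  Maps of simplicial sets are extensional in each degree, so \<open>sset_hom A B\<close> has exactly one element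
  for each natural transformation.
\<close>

definition sset_hom :: "'a sset \<Rightarrow> 'b sset \<Rightarrow> (nat \<Rightarrow> 'a \<Rightarrow> 'b) set" where
  "sset_hom A B = {f. (\<forall>n. f n \<in> cells A n \<rightarrow>\<^sub>E cells B n) \<and>
     (\<forall>m n. \<forall>\<theta>\<in>ord_maps m n. \<forall>x\<in>cells A n. f m (act A m n \<theta> x) = act B m n \<theta> (f n x))}"

definition sset_comp ::
    "'a sset \<Rightarrow> (nat \<Rightarrow> 'b \<Rightarrow> 'c) \<Rightarrow> (nat \<Rightarrow> 'a \<Rightarrow> 'b) \<Rightarrow> nat \<Rightarrow> 'a \<Rightarrow> 'c" where
  "sset_comp A g f = (\<lambda>n. compose (cells A n) (g n) (f n))"

text \<open>
  The inclusion of \<open>A\<close> into any simplicial set of which it is a simplicial subset; in particular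
  the identity of \<open>A\<close>.
\<close>

definition sset_incl :: "'a sset \<Rightarrow> nat \<Rightarrow> 'a \<Rightarrow> 'a" where
  "sset_incl A = (\<lambda>n. \<lambda>x\<in>cells A n. x)"

definition sset_prod :: "'a sset \<Rightarrow> 'b sset \<Rightarrow> ('a \<times> 'b) sset" where
  "sset_prod A B = \<lparr> cells = (\<lambda>n. cells A n \<times> cells B n),
     act = (\<lambda>m n \<theta> (x, y). (act A m n \<theta> x, act B m n \<theta> y)) \<rparr>"

definition sset_prod_map :: "'a sset \<Rightarrow> 'b sset \<Rightarrow> (nat \<Rightarrow> 'a \<Rightarrow> 'c) \<Rightarrow> (nat \<Rightarrow> 'b \<Rightarrow> 'd) \<Rightarrow>
    nat \<Rightarrow> 'a \<times> 'b \<Rightarrow> 'c \<times> 'd" where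
  "sset_prod_map A B f g = (\<lambda>n. \<lambda>(x, y)\<in>cells A n \<times> cells B n. (f n x, g n y))"

definition std_simplex :: "nat \<Rightarrow> (nat \<Rightarrow> nat) sset" (\<open>\<Delta>[_]\<close>) where
  "\<Delta>[n] = \<lparr> cells = (\<lambda>m. ord_maps m n), act = (\<lambda>l m \<theta> \<sigma>. compose {..l} \<sigma> \<theta>) \<rparr>"

text \<open>The map \<open>\<Delta>[m] \<rightarrow> \<Delta>[n]\<close> induced by \<open>\<theta> : [m] \<rightarrow> [n]\<close>.\<close>

definition std_simplex_map :: "nat \<Rightarrow> (nat \<Rightarrow> nat) \<Rightarrow> nat \<Rightarrow> (nat \<Rightarrow> nat) \<Rightarrow> nat \<Rightarrow> nat" where
  "std_simplex_map m \<theta> = (\<lambda>k. \<lambda>\<sigma>\<in>cells \<Delta>[m] k. compose {..k} \<theta> \<sigma>)"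

text \<open>A simplex of \<open>\<Delta>[n]\<close> lies in the face opposite \<open>l\<close> iff \<open>l\<close> is not one of its vertices.\<close>

definition face :: "nat \<Rightarrow> nat \<Rightarrow> (nat \<Rightarrow> nat) sset" where
  "face n l = \<Delta>[n]\<lparr> cells := (\<lambda>m. {\<sigma> \<in> cells \<Delta>[n] m. l \<notin> \<sigma> ` {..m}}) \<rparr>"

definition faces_union :: "nat \<Rightarrow> nat set \<Rightarrow> (nat \<Rightarrow> nat) sset" where
  "faces_union n L = \<Delta>[n]\<lparr> cells := (\<lambda>m. \<Union>l\<in>L. cells (face n l) m) \<rparr>"

definition simplex_boundary :: "nat \<Rightarrow> (nat \<Rightarrow> nat) sset" (\<open>\<partial>\<Delta>[_]\<close>) where
  "\<partial>\<Delta>[n] = faces_union n {..n}"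

text \<open>\<open>\<Lambda>\<^sup>2[i,j;n]\<close> is the horn usually written \<open>\<Lambda>\<close> with superscript \<open>i,j\<close>; it is used only for broken \<open>{i, j}\<close>.\<close>

definition segal_horn :: "nat \<Rightarrow> nat \<Rightarrow> nat \<Rightarrow> (nat \<Rightarrow> nat) sset" (\<open>\<Lambda>\<^sup>2[_,_;_]\<close>) where
  "\<Lambda>\<^sup>2[i,j;n] = faces_union n ({..n} - {i, j})"

definition broken :: "nat \<Rightarrow> nat set \<Rightarrow> bool" where
  "broken n S \<longleftrightarrow> 3 \<le> n \<and> S \<subseteq> {..n} \<and>
     (\<exists>i j k l. i < j \<and> j < k \<and> k < l \<and> l \<le> n \<and>
        (i \<in> S \<and> k \<in> S \<and> j \<notin> S \<and> l \<notin> S \<or> i \<notin> S \<and> k \<notin> S \<and> j \<in> S \<and> l \<in> S))"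

definition quasi_2_segal :: "'a sset \<Rightarrow> bool" where
  "quasi_2_segal X \<longleftrightarrow> simplicial_set X \<and>
     (\<forall>n\<ge>3. \<forall>i j. i \<noteq> j \<and> broken n {i, j} \<longrightarrow>
        (\<forall>f\<in>sset_hom \<Lambda>\<^sup>2[i,j;n] X. \<exists>g\<in>sset_hom \<Delta>[n] X.
           sset_comp \<Lambda>\<^sup>2[i,j;n] g (sset_incl \<Lambda>\<^sup>2[i,j;n]) = f))"

definition map_sset :: "'a sset \<Rightarrow> 'b sset \<Rightarrow> (nat \<Rightarrow> 'a \<times> (nat \<Rightarrow> nat) \<Rightarrow> 'b) sset" where
  "map_sset A X = \<lparr> cells = (\<lambda>n. sset_hom (sset_prod A \<Delta>[n]) X),
     act = (\<lambda>m n \<theta> f. sset_comp (sset_prod A \<Delta>[m]) f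
              (sset_prod_map A \<Delta>[m] (sset_incl A) (std_simplex_map m \<theta>))) \<rparr>"

text \<open>
  The map \<open>Map(B, X) \<rightarrow> Map(A, X)\<close> given by precomposition with \<open>j : A \<rightarrow> B\<close>.
\<close>

definition map_precomp :: "'a sset \<Rightarrow> 'b sset \<Rightarrow> 'c sset \<Rightarrow> (nat \<Rightarrow> 'a \<Rightarrow> 'b) \<Rightarrow>
    nat \<Rightarrow> (nat \<Rightarrow> 'b \<times> (nat \<Rightarrow> nat) \<Rightarrow> 'c) \<Rightarrow> nat \<Rightarrow> 'a \<times> (nat \<Rightarrow> nat) \<Rightarrow> 'c" where
  "map_precomp A B X j = (\<lambda>n. \<lambda>f\<in>cells (map_sset B X) n.
     sset_comp (sset_prod A \<Delta>[n]) f (sset_prod_map A \<Delta>[n] j (sset_incl \<Delta>[n])))"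

text \<open>The map \<open>p : E \<rightarrow> Y\<close> has the right lifting property with respect to \<open>i : A \<rightarrow> B\<close>.\<close>

definition has_rlp :: "'a sset \<Rightarrow> 'b sset \<Rightarrow> (nat \<Rightarrow> 'a \<Rightarrow> 'b) \<Rightarrow>
    'e sset \<Rightarrow> 'y sset \<Rightarrow> (nat \<Rightarrow> 'e \<Rightarrow> 'y) \<Rightarrow> bool" where
  "has_rlp A B i E Y p \<longleftrightarrow>
     (\<forall>u\<in>sset_hom A E. \<forall>v\<in>sset_hom B Y. sset_comp A p u = sset_comp A v i \<longrightarrow>
        (\<exists>w\<in>sset_hom B E. sset_comp A w i = u \<and> sset_comp B p w = v))"

definition trivial_fibration :: "'e sset \<Rightarrow> 'y sset \<Rightarrow> (nat \<Rightarrow> 'e \<Rightarrow> 'y) \<Rightarrow> bool" where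
  "trivial_fibration E Y p \<longleftrightarrow> simplicial_set E \<and> simplicial_set Y \<and> p \<in> sset_hom E Y \<and>
     (\<forall>n. has_rlp \<partial>\<Delta>[n] \<Delta>[n] (sset_incl \<partial>\<Delta>[n]) E Y p)"

end

theory Submission
  imports Defs "HOL-Library.Infinite_Set"
begin

text \<open>
  By adjunction, the two maps are trivial fibrations iff every map from the corner
  \<open>(\<Lambda> \<times> \<Delta>[n]) \<union> (\<Delta>[3] \<times> \<partial>\<Delta>[n])\<close> to \<open>X\<close> extends to \<open>\<Delta>[3] \<times> \<Delta>[n]\<close>, where \<open>\<Lambda>\<close> is
  \<open>\<Lambda>\<^sup>2[0,2;3]\<close> or \<open>\<Lambda>\<^sup>2[1,3;3]\<close>.

  If such extensions exist, they also exist with any union of faces of \<open>\<Delta>[n]\<close> in place of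
  \<open>\<partial>\<Delta>[n]\<close>, and the inclusion \<open>\<Lambda>\<^sup>2[i,j;n] \<rightarrow> \<Delta>[n]\<close> is a retract of the resulting corner
  inclusion.

  Conversely, let \<open>\<Lambda> = \<Lambda>\<^sup>2[e,e+2;3]\<close>. A nondegenerate simplex outside the corner is a chain in
  the grid \<open>[3] \<times> [n]\<close> that meets every column and the two rows other than \<open>e\<close> and \<open>e+2\<close>. If \<open>a\<close>
  and \<open>b\<close> are the least and greatest column in which it meets row \<open>e+1\<close>, then the points \<open>(e,a)\<close> and
  \<open>(e+2,b)\<close> can be added or removed freely, so these chains come in disjoint quadruples.
  Ordered by \<open>b - a\<close> and then by dimension, each quadruple is attached along a 2-Segal horn.
\<close>

section \<open>Simplicial subsets and extension of maps\<close>

lemma ord_mapsD: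
  assumes "\<theta> \<in> ord_maps m n"
  shows "i \<le> m \<Longrightarrow> \<theta> i \<le> n" and "i \<le> j \<Longrightarrow> j \<le> m \<Longrightarrow> \<theta> i \<le> \<theta> j"
    and "\<not> i \<le> m \<Longrightarrow> \<theta> i = undefined"
  using assms by (auto simp: ord_maps_def mono_on_def PiE_def Pi_def extensional_def)

lemma ord_maps_restrictI:
  assumes "\<And>i. i \<le> m \<Longrightarrow> f i \<le> n" and "\<And>i j. i \<le> j \<Longrightarrow> j \<le> m \<Longrightarrow> f i \<le> f j"
  shows "restrict f {..m} \<in> ord_maps m n"
  using assms by (auto simp: ord_maps_def mono_on_def)

lemma ord_maps_eqI:
  assumes "\<theta> \<in> ord_maps m n" and "\<phi> \<in> ord_maps m k" and "\<And>i. i \<le> m \<Longrightarrow> \<theta> i = \<phi> i"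
  shows "\<theta> = \<phi>"
  by (metis assms ext ord_mapsD(3))

lemma ord_maps_id [simp]: "(\<lambda>i\<in>{..m}. i) \<in> ord_maps m m"
  by (rule ord_maps_restrictI) auto

lemma ord_maps_compose:
  assumes "\<theta> \<in> ord_maps l m" and "\<phi> \<in> ord_maps m n"
  shows "compose {..l} \<phi> \<theta> \<in> ord_maps l n"
  unfolding compose_def using assms ord_mapsD[OF assms(1)] ord_mapsD[OF assms(2)]
  by (auto intro!: ord_maps_restrictI)

lemma compose_ord_maps_id:
  assumes "\<theta> \<in> ord_maps l m"
  shows "compose {..l} \<theta> (\<lambda>i\<in>{..l}. i) = \<theta>" and "compose {..l} (\<lambda>i\<in>{..m}. i) \<theta> = \<theta>"
  using ord_mapsD[OF assms] by (auto simp: compose_def)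

lemma compose_ord_maps_assoc:
  assumes "\<theta> \<in> ord_maps k l"
  shows "compose {..k} (compose {..l} \<psi> \<phi>) \<theta> = compose {..k} \<psi> (compose {..k} \<phi> \<theta>)"
  using ord_mapsD[OF assms] by (auto simp: compose_def)

lemma std_simplex_simps [simp]:
  "cells \<Delta>[n] m = ord_maps m n" "act \<Delta>[n] l m \<theta> \<sigma> = compose {..l} \<sigma> \<theta>"
  by (simp_all add: std_simplex_def)

lemma sset_prod_simps [simp]:
  "cells (sset_prod A B) n = cells A n \<times> cells B n"
  "act (sset_prod A B) m n \<theta> (x, y) = (act A m n \<theta> x, act B m n \<theta> y)"
  by (simp_all add: sset_prod_def)

lemma simplicial_set_std_simplex: "simplicial_set \<Delta>[n]"
  by unfold_locales
    (auto simp: ord_maps_compose compose_ord_maps_id compose_ord_maps_assoc)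

lemma simplicial_set_prod:
  assumes "simplicial_set A" and "simplicial_set B"
  shows "simplicial_set (sset_prod A B)"
proof -
  interpret A: simplicial_set A by fact
  interpret B: simplicial_set B by fact
  show ?thesis
    by unfold_locales
      (auto simp: A.act_closed B.act_closed A.act_id B.act_id A.act_comp B.act_comp)
qed

section \<open>Subcomplexes, and natural maps without extensionality\<close>

definition subcomplex :: "'a sset \<Rightarrow> (nat \<Rightarrow> 'a set) \<Rightarrow> bool" where
  "subcomplex Z K \<longleftrightarrow> (\<forall>n. K n \<subseteq> cells Z n) \<and>
     (\<forall>m n. \<forall>\<theta>\<in>ord_maps m n. \<forall>x\<in>K n. act Z m n \<theta> x \<in> K m)"

lemma subcomplexD:
  assumes "subcomplex Z K"
  shows "x \<in> K n \<Longrightarrow> x \<in> cells Z n"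
    and "\<theta> \<in> ord_maps m n \<Longrightarrow> x \<in> K n \<Longrightarrow> act Z m n \<theta> x \<in> K m"
  using assms by (auto simp: subcomplex_def)

lemma simplicial_set_subcomplex:
  assumes "simplicial_set Z" and "subcomplex Z K"
  shows "simplicial_set (Z\<lparr>cells := K\<rparr>)"
proof -
  interpret simplicial_set Z by fact
  show ?thesis
    by unfold_locales (auto simp: subcomplexD[OF assms(2)] act_id act_comp)
qed

lemma subcomplex_cells: "simplicial_set Z \<Longrightarrow> subcomplex Z (cells Z)"
  by (auto simp: subcomplex_def simplicial_set.act_closed)

text \<open>\<open>sset_hom\<close> without the extensionality clause: values off the cells are
  free, so maps can be composed or defined by cases without restricting them each time.\<close>

definition natural_map :: "'a sset \<Rightarrow> 'b sset \<Rightarrow> (nat \<Rightarrow> 'a \<Rightarrow> 'b) \<Rightarrow> bool" where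
  "natural_map A B f \<longleftrightarrow> (\<forall>n. \<forall>x\<in>cells A n. f n x \<in> cells B n) \<and>
     (\<forall>m n. \<forall>\<theta>\<in>ord_maps m n. \<forall>x\<in>cells A n. f m (act A m n \<theta> x) = act B m n \<theta> (f n x))"

lemma natural_mapD:
  assumes "natural_map A B f"
  shows "x \<in> cells A n \<Longrightarrow> f n x \<in> cells B n"
    and "\<theta> \<in> ord_maps m n \<Longrightarrow> x \<in> cells A n \<Longrightarrow> f m (act A m n \<theta> x) = act B m n \<theta> (f n x)"
  using assms by (auto simp: natural_map_def)

lemma sset_hom_natural: "f \<in> sset_hom A B \<Longrightarrow> natural_map A B f"
  by (auto simp: sset_hom_def natural_map_def)

lemma natural_restrict_sset_hom:
  assumes "natural_map A B f" and "simplicial_set A"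
  shows "(\<lambda>n. restrict (f n) (cells A n)) \<in> sset_hom A B"
  using assms by (auto simp: sset_hom_def natural_map_def simplicial_set.act_closed)

text \<open>Injectivity of \<open>X\<close> relative to the inclusion of \<open>K\<close> into
  \<open>K'\<close>. Both are families of cells in one ambient \<open>Z\<close>, so that the steps
  of a filtration can be chained by \<open>extendable_trans\<close>.\<close>

definition extendable :: "'b sset \<Rightarrow> 'a sset \<Rightarrow> (nat \<Rightarrow> 'a set) \<Rightarrow> (nat \<Rightarrow> 'a set) \<Rightarrow> bool" where
  "extendable X Z K K' \<longleftrightarrow> (\<forall>f. natural_map (Z\<lparr>cells := K\<rparr>) X f \<longrightarrow>
     (\<exists>g. natural_map (Z\<lparr>cells := K'\<rparr>) X g \<and> (\<forall>n. \<forall>x\<in>K n. g n x = f n x)))"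

lemma extendable_refl: "extendable X Z K K"
  by (auto simp: extendable_def)

lemma extendable_trans:
  assumes "extendable X Z K K'" and "extendable X Z K' K''" and "\<And>n. K n \<subseteq> K' n"
  shows "extendable X Z K K''"
  unfolding extendable_def
proof (intro allI impI)
  fix f assume "natural_map (Z\<lparr>cells := K\<rparr>) X f"
  then obtain g where g: "natural_map (Z\<lparr>cells := K'\<rparr>) X g" "\<forall>n. \<forall>x\<in>K n. g n x = f n x"
    using assms(1) unfolding extendable_def by blast
  then obtain h where "natural_map (Z\<lparr>cells := K''\<rparr>) X h" "\<forall>n. \<forall>x\<in>K' n. h n x = g n x"
    using assms(2) unfolding extendable_def by blast
  with g assms(3) show "\<exists>g. natural_map (Z\<lparr>cells := K''\<rparr>) X g \<and> (\<forall>n. \<forall>x\<in>K n. g n x = f n x)"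
    by (metis subsetD)
qed

text \<open>Restricting a natural map to the cells makes it extensional, and composing with
  \<open>sset_incl\<close> restricts a map to \<open>K\<close>, both sides being
  \<open>undefined\<close> elsewhere.\<close>

lemma extendable_iff_sset_hom:
  assumes Z: "simplicial_set Z" and K: "subcomplex Z K"
  shows "extendable X Z K (cells Z) \<longleftrightarrow>
    (\<forall>f\<in>sset_hom (Z\<lparr>cells := K\<rparr>) X. \<exists>g\<in>sset_hom Z X.
       sset_comp (Z\<lparr>cells := K\<rparr>) g (sset_incl (Z\<lparr>cells := K\<rparr>)) = f)" (is "_ \<longleftrightarrow> ?R")
proof
  note K' = simplicial_set_subcomplex[OF assms]
  show ?R if ext: "extendable X Z K (cells Z)"
  proof
    fix f assume f: "f \<in> sset_hom (Z\<lparr>cells := K\<rparr>) X"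
    then obtain g where g: "natural_map Z X g" "\<forall>n. \<forall>x\<in>K n. g n x = f n x"
      using ext sset_hom_natural[OF f] unfolding extendable_def by auto
    let ?g = "\<lambda>n. restrict (g n) (cells Z n)"
    have "sset_comp (Z\<lparr>cells := K\<rparr>) ?g (sset_incl (Z\<lparr>cells := K\<rparr>)) n x = f n x" for n x
      using f g(2) subcomplexD[OF K]
      by (cases "x \<in> K n")
        (auto simp: sset_comp_def sset_incl_def compose_def sset_hom_def PiE_def extensional_def)
    with natural_restrict_sset_hom[OF g(1) Z]
    show "\<exists>g\<in>sset_hom Z X. sset_comp (Z\<lparr>cells := K\<rparr>) g (sset_incl (Z\<lparr>cells := K\<rparr>)) = f"
      by blast
  qed
  show "extendable X Z K (cells Z)" if R: ?R
    unfolding extendable_def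
  proof (intro allI impI)
    fix f assume f: "natural_map (Z\<lparr>cells := K\<rparr>) X f"
    let ?f = "\<lambda>n. restrict (f n) (cells (Z\<lparr>cells := K\<rparr>) n)"
    from R natural_restrict_sset_hom[OF f K'] obtain g where g: "g \<in> sset_hom Z X"
      "sset_comp (Z\<lparr>cells := K\<rparr>) g (sset_incl (Z\<lparr>cells := K\<rparr>)) = ?f"
      by blast
    have "g n x = f n x" if "x \<in> K n" for n x
      using that fun_cong[OF fun_cong[OF g(2), of n], of x]
      by (simp add: sset_comp_def sset_incl_def compose_def)
    with sset_hom_natural[OF g(1)]
    show "\<exists>g. natural_map (Z\<lparr>cells := cells Z\<rparr>) X g \<and> (\<forall>n. \<forall>x\<in>K n. g n x = f n x)"
      by auto
  qed
qed

text \<open>Since \<open>s\<close> is degreewise injective, the union of \<open>K\<close> and the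
  image of \<open>s\<close> is the pushout of \<open>K\<close> and \<open>B\<close> along the
  preimage of \<open>K\<close>. A map on the union is thus a map on \<open>K\<close> with a
  compatible map on \<open>B\<close>.\<close>

lemma extendable_pushout:
  assumes K: "subcomplex Z K" and s: "natural_map B Z s" and inj: "\<And>n. inj_on (s n) (cells B n)"
    and B: "simplicial_set B"
    and ext: "extendable X B (\<lambda>n. {b \<in> cells B n. s n b \<in> K n}) (cells B)"
  shows "extendable X Z K (\<lambda>n. K n \<union> s n ` cells B n)"
  unfolding extendable_def
proof (intro allI impI)
  fix f assume f: "natural_map (Z\<lparr>cells := K\<rparr>) X f"
  note fD = natural_mapD[OF f, simplified]
  note sD = natural_mapD[OF s]
  have "natural_map (B\<lparr>cells := \<lambda>n. {b \<in> cells B n. s n b \<in> K n}\<rparr>) X (\<lambda>n b. f n (s n b))"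
    unfolding natural_map_def
    using fD sD subcomplexD[OF K] simplicial_set.act_closed[OF B] by auto
  then obtain g where g: "natural_map B X g"
      and gf: "\<And>n b. b \<in> cells B n \<Longrightarrow> s n b \<in> K n \<Longrightarrow> g n b = f n (s n b)"
    using ext unfolding extendable_def by auto
  note gD = natural_mapD[OF g]
  \<comment> \<open>\<open>K\<close> takes precedence; on the overlap \<open>gf\<close> makes both
    choices agree, so \<open>h\<close> follows \<open>g\<close> on the whole image of
    \<open>s\<close>.\<close>
  define h where "h n z = (if z \<in> K n then f n z else g n (inv_into (cells B n) (s n) z))" for n z
  have hs: "h n (s n b) = g n b" if "b \<in> cells B n" for n b
    using that inj by (auto simp: h_def gf)
  have hf: "h n z = f n z" if "z \<in> K n" for n z
    using that by (simp add: h_def)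
  have "natural_map (Z\<lparr>cells := \<lambda>n. K n \<union> s n ` cells B n\<rparr>) X h"
    unfolding natural_map_def
  proof (intro conjI allI ballI)
    fix n x assume "x \<in> cells (Z\<lparr>cells := \<lambda>n. K n \<union> s n ` cells B n\<rparr>) n"
    then show "h n x \<in> cells X n"
      using hs hf fD gD by auto
  next
    fix m n \<theta> x
    assume \<theta>: "\<theta> \<in> ord_maps m n" and x: "x \<in> cells (Z\<lparr>cells := \<lambda>n. K n \<union> s n ` cells B n\<rparr>) n"
    from x consider "x \<in> K n" | b where "b \<in> cells B n" "x = s n b" by auto
    then show "h m (act (Z\<lparr>cells := \<lambda>n. K n \<union> s n ` cells B n\<rparr>) m n \<theta> x) = act X m n \<theta> (h n x)"
    proof cases
      case 1
      then show ?thesis using \<theta> subcomplexD[OF K] by (simp add: hf fD)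
    next
      case 2
      have "act Z m n \<theta> x = s m (act B m n \<theta> b)" using 2 \<theta> sD by simp
      then show ?thesis
        using 2 \<theta> simplicial_set.act_closed[OF B] by (simp add: hs gD)
    qed
  qed
  then show "\<exists>g. natural_map (Z\<lparr>cells := \<lambda>n. K n \<union> s n ` cells B n\<rparr>) X g \<and> (\<forall>n. \<forall>x\<in>K n. g n x = f n x)"
    using hf by blast
qed

section \<open>The adjunction for pushout corners\<close>

lemma map_sset_simps [simp]:
  "cells (map_sset A X) n = sset_hom (sset_prod A \<Delta>[n]) X"
  by (simp add: map_sset_def)

lemma sset_comp_apply: "sset_comp A g f n x = (if x \<in> cells A n then g n (f n x) else undefined)"
  by (simp add: sset_comp_def compose_def)

lemma sset_incl_apply: "sset_incl A n x = (if x \<in> cells A n then x else undefined)"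
  by (simp add: sset_incl_def)

lemma sset_hom_undefined:
  "f \<in> sset_hom A B \<Longrightarrow> x \<notin> cells A n \<Longrightarrow> f n x = undefined"
  by (auto simp: sset_hom_def PiE_def extensional_def)

lemma act_map_sset:
  assumes "\<theta> \<in> ord_maps m n"
  shows "act (map_sset A X) m n \<theta> f l (x, \<rho>) =
    (if x \<in> cells A l \<and> \<rho> \<in> ord_maps l m then f l (x, compose {..l} \<theta> \<rho>) else undefined)"
  by (auto simp: map_sset_def sset_comp_def compose_def sset_prod_map_def sset_incl_def
      std_simplex_map_def)

text \<open>A simplex \<open>\<tau>\<close> of \<open>\<Delta>[n]\<close> classifies a map
  \<open>\<Delta>[m] \<rightarrow> \<Delta>[n]\<close>, along which \<open>g\<close> is pulled back.
  The restriction is there because simplices of a mapping complex are extensional.\<close>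

definition curry_map :: "'a sset \<Rightarrow> (nat \<Rightarrow> 'a \<times> (nat \<Rightarrow> nat) \<Rightarrow> 'c) \<Rightarrow>
    nat \<Rightarrow> (nat \<Rightarrow> nat) \<Rightarrow> nat \<Rightarrow> 'a \<times> (nat \<Rightarrow> nat) \<Rightarrow> 'c" where
  "curry_map A g m \<tau> = (\<lambda>l. \<lambda>(x, \<rho>)\<in>cells (sset_prod A \<Delta>[m]) l. g l (x, compose {..l} \<tau> \<rho>))"

text \<open>Yoneda: a map into a mapping complex is recovered by evaluating each
  \<open>u m \<tau>\<close> at the universal simplex, the identity of \<open>[m]\<close>.\<close>

definition uncurry_map :: "(nat \<Rightarrow> (nat \<Rightarrow> nat) \<Rightarrow> nat \<Rightarrow> 'a \<times> (nat \<Rightarrow> nat) \<Rightarrow> 'c) \<Rightarrow>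
    nat \<Rightarrow> 'a \<times> (nat \<Rightarrow> nat) \<Rightarrow> 'c" where
  "uncurry_map u m = (\<lambda>(x, \<tau>). u m \<tau> m (x, \<lambda>i\<in>{..m}. i))"

text \<open>Data for the pushout-product of the inclusion of \<open>L\<close> in \<open>B\<close>
  with inclusions of subcomplexes \<open>K\<close> in \<open>\<Delta>[n]\<close>. In the application
  \<open>B\<close> is \<open>\<Delta>[3]\<close> and \<open>L\<close> a 2-Segal horn.\<close>

locale pushout_corner =
  fixes X :: "'c sset" and B :: "'a sset" and L :: "nat \<Rightarrow> 'a set"
  assumes X: "simplicial_set X" and B: "simplicial_set B" and L: "subcomplex B L"
begin

section \<open>Mapping complexes and currying\<close>

lemma simplicial_set_map_sset:
  assumes A: "simplicial_set A"
  shows "simplicial_set (map_sset (A :: 'a sset) X)"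
proof -
  interpret A: simplicial_set A by fact
  have closed: "act (map_sset A X) m n \<theta> f \<in> cells (map_sset A X) m"
    if \<theta>: "\<theta> \<in> ord_maps m n" and f: "f \<in> cells (map_sset A X) n" for m n \<theta> f
  proof -
    note fD = natural_mapD[OF sset_hom_natural[OF f[simplified]]]
    have *: "natural_map (sset_prod A \<Delta>[m]) X (act (map_sset A X) m n \<theta> f)"
      unfolding natural_map_def
    proof (intro conjI allI ballI)
      fix l z assume "z \<in> cells (sset_prod A \<Delta>[m]) l"
      then show "act (map_sset A X) m n \<theta> f l z \<in> cells X l"
        using \<theta> fD(1) by (auto simp: act_map_sset ord_maps_compose)
    next
      fix k l \<phi> z assume \<phi>: "\<phi> \<in> ord_maps k l" and z: "z \<in> cells (sset_prod A \<Delta>[m]) l"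
      obtain x \<rho> where [simp]: "z = (x, \<rho>)" and x: "x \<in> cells A l" and \<rho>: "\<rho> \<in> ord_maps l m"
        using z by auto
      have "f k (act (sset_prod A \<Delta>[n]) k l \<phi> (x, compose {..l} \<theta> \<rho>)) =
          act X k l \<phi> (f l (x, compose {..l} \<theta> \<rho>))"
        using \<phi> x \<rho> \<theta> by (intro fD(2)) (auto simp: ord_maps_compose)
      then show "act (map_sset A X) m n \<theta> f k (act (sset_prod A \<Delta>[m]) k l \<phi> z) =
          act X k l \<phi> (act (map_sset A X) m n \<theta> f l z)"
        using \<theta> x \<rho> \<phi>
        by (simp add: act_map_sset ord_maps_compose A.act_closed compose_ord_maps_assoc)
    qed
    \<comment> \<open>The action on a mapping complex is already extensional, so restricting its
      values changes nothing.\<close>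
    have "(\<lambda>l. restrict (act (map_sset A X) m n \<theta> f l) (cells (sset_prod A \<Delta>[m]) l)) =
        act (map_sset A X) m n \<theta> f"
      using \<theta> by (auto simp: fun_eq_iff act_map_sset restrict_def)
    with natural_restrict_sset_hom[OF * simplicial_set_prod[OF A simplicial_set_std_simplex]]
    show ?thesis by simp
  qed
  show ?thesis
  proof
    show "act (map_sset A X) m n \<theta> f \<in> cells (map_sset A X) m"
      if "\<theta> \<in> ord_maps m n" and "f \<in> cells (map_sset A X) n" for m n \<theta> f
      using closed that .
    show "act (map_sset A X) n n (\<lambda>i\<in>{..n}. i) f = f" if "f \<in> cells (map_sset A X) n" for n f
    proof (intro ext)
      fix l z show "act (map_sset A X) n n (\<lambda>i\<in>{..n}. i) f l z = f l z"
        using sset_hom_undefined[OF that[simplified]]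
        by (cases z) (auto simp: act_map_sset compose_ord_maps_id)
    qed
    show "act (map_sset A X) l n (compose {..l} \<phi> \<theta>) f =
        act (map_sset A X) l m \<theta> (act (map_sset A X) m n \<phi> f)"
      if "\<theta> \<in> ord_maps l m" and "\<phi> \<in> ord_maps m n" and "f \<in> cells (map_sset A X) n" for l m n \<theta> \<phi> f
    proof (intro ext)
      fix k z show "act (map_sset A X) l n (compose {..l} \<phi> \<theta>) f k z =
        act (map_sset A X) l m \<theta> (act (map_sset A X) m n \<phi> f) k z"
        using that
        by (cases z) (auto simp: act_map_sset ord_maps_compose compose_ord_maps_assoc)
    qed
  qed
qed

lemma curry_map_in_hom:
  assumes A: "simplicial_set A" and K: "subcomplex \<Delta>[n] K"
    and g: "natural_map (sset_prod A (\<Delta>[n]\<lparr>cells := K\<rparr>)) X g" and \<tau>: "\<tau> \<in> K m"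
  shows "curry_map A g m \<tau> \<in> sset_hom (sset_prod A \<Delta>[m]) X"
proof -
  interpret A: simplicial_set A by fact
  note gD = natural_mapD[OF g]
  have \<tau>': "compose {..l} \<tau> \<rho> \<in> K l" if "\<rho> \<in> ord_maps l m" for l \<rho>
    using subcomplexD(2)[OF K that \<tau>] by simp
  have "natural_map (sset_prod A \<Delta>[m]) X (\<lambda>l (x, \<rho>). g l (x, compose {..l} \<tau> \<rho>))"
    unfolding natural_map_def
  proof (intro conjI allI ballI)
    fix l z assume "z \<in> cells (sset_prod A \<Delta>[m]) l"
    then show "(case z of (x, \<rho>) \<Rightarrow> g l (x, compose {..l} \<tau> \<rho>)) \<in> cells X l"
      using gD(1) \<tau>' by auto
  next
    fix k l \<phi> z assume \<phi>: "\<phi> \<in> ord_maps k l" and z: "z \<in> cells (sset_prod A \<Delta>[m]) l"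
    obtain x \<rho> where [simp]: "z = (x, \<rho>)" and x: "x \<in> cells A l" and \<rho>: "\<rho> \<in> ord_maps l m"
      using z by auto
    have "g k (act (sset_prod A (\<Delta>[n]\<lparr>cells := K\<rparr>)) k l \<phi> (x, compose {..l} \<tau> \<rho>)) =
        act X k l \<phi> (g l (x, compose {..l} \<tau> \<rho>))"
      using \<phi> x \<tau>'[OF \<rho>] by (intro gD(2)) auto
    then show "(case act (sset_prod A \<Delta>[m]) k l \<phi> z of (x, \<rho>) \<Rightarrow> g k (x, compose {..k} \<tau> \<rho>)) =
        act X k l \<phi> (case z of (x, \<rho>) \<Rightarrow> g l (x, compose {..l} \<tau> \<rho>))"
      using \<phi> by (simp add: compose_ord_maps_assoc)
  qed
  from natural_restrict_sset_hom[OF this simplicial_set_prod[OF A simplicial_set_std_simplex]]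
  show ?thesis unfolding curry_map_def .
qed

lemma curry_map_natural:
  assumes A: "simplicial_set A" and K: "subcomplex \<Delta>[n] K"
    and g: "natural_map (sset_prod A (\<Delta>[n]\<lparr>cells := K\<rparr>)) X g"
  shows "(\<lambda>m. restrict (curry_map A g m) (K m)) \<in> sset_hom (\<Delta>[n]\<lparr>cells := K\<rparr>) (map_sset A X)"
proof -
  have "natural_map (\<Delta>[n]\<lparr>cells := K\<rparr>) (map_sset A X) (curry_map A g)"
    unfolding natural_map_def
  proof (intro conjI allI ballI)
    fix m \<tau> assume "\<tau> \<in> cells (\<Delta>[n]\<lparr>cells := K\<rparr>) m"
    then show "curry_map A g m \<tau> \<in> cells (map_sset A X) m"
      using curry_map_in_hom[OF assms] by simp
  next
    fix l m \<theta> \<tau> assume \<theta>: "\<theta> \<in> ord_maps l m" and \<tau>: "\<tau> \<in> cells (\<Delta>[n]\<lparr>cells := K\<rparr>) m"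
    show "curry_map A g l (act (\<Delta>[n]\<lparr>cells := K\<rparr>) l m \<theta> \<tau>) =
        act (map_sset A X) l m \<theta> (curry_map A g m \<tau>)"
    proof (intro ext)
      fix k z
      show "curry_map A g l (act (\<Delta>[n]\<lparr>cells := K\<rparr>) l m \<theta> \<tau>) k z =
          act (map_sset A X) l m \<theta> (curry_map A g m \<tau>) k z"
        using \<theta> by (cases z)
          (auto simp: curry_map_def act_map_sset ord_maps_compose compose_ord_maps_assoc)
    qed
  qed
  from natural_restrict_sset_hom[OF this
      simplicial_set_subcomplex[OF simplicial_set_std_simplex K]]
  show ?thesis by simp
qed

text \<open>Naturality of \<open>u\<close> along \<open>\<rho>\<close> identifies the simplex at
  \<open>\<tau> \<circ> \<rho>\<close> with the pullback of the simplex at \<open>\<tau>\<close>;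
  both are then evaluated at the identity of \<open>[l]\<close>. So \<open>u\<close> is determined
  by its values at identities.\<close>

lemma sset_hom_map_sset_eq_uncurry:
  assumes K: "subcomplex \<Delta>[n] K"
    and u: "u \<in> sset_hom (\<Delta>[n]\<lparr>cells := K\<rparr>) (map_sset A X)"
    and \<tau>: "\<tau> \<in> K m" and x: "x \<in> cells A l" and \<rho>: "\<rho> \<in> ord_maps l m"
  shows "u m \<tau> l (x, \<rho>) = uncurry_map u l (x, compose {..l} \<tau> \<rho>)"
proof -
  have "u l (compose {..l} \<tau> \<rho>) = act (map_sset A X) l m \<rho> (u m \<tau>)"
    using natural_mapD(2)[OF sset_hom_natural[OF u] \<rho>] \<tau> by simp
  then show ?thesis
    using x \<rho> by (simp add: uncurry_map_def act_map_sset compose_ord_maps_id)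
qed

lemma uncurry_map_natural:
  assumes A: "simplicial_set A" and K: "subcomplex \<Delta>[n] K"
    and u: "u \<in> sset_hom (\<Delta>[n]\<lparr>cells := K\<rparr>) (map_sset A X)"
  shows "natural_map (sset_prod A (\<Delta>[n]\<lparr>cells := K\<rparr>)) X (uncurry_map u)"
  unfolding natural_map_def
proof (intro conjI allI ballI)
  interpret A: simplicial_set A by fact
  have u': "u m \<tau> \<in> sset_hom (sset_prod A \<Delta>[m]) X" if "\<tau> \<in> K m" for m \<tau>
    using natural_mapD(1)[OF sset_hom_natural[OF u]] that by simp
  {
    fix l z assume "z \<in> cells (sset_prod A (\<Delta>[n]\<lparr>cells := K\<rparr>)) l"
    then show "uncurry_map u l z \<in> cells X l"
      using natural_mapD(1)[OF sset_hom_natural[OF u']] by (auto simp: uncurry_map_def)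
  next
    fix k l \<phi> z assume \<phi>: "\<phi> \<in> ord_maps k l"
      and z: "z \<in> cells (sset_prod A (\<Delta>[n]\<lparr>cells := K\<rparr>)) l"
    obtain x \<tau> where [simp]: "z = (x, \<tau>)" and x: "x \<in> cells A l" and \<tau>: "\<tau> \<in> K l"
      using z by auto
    \<comment> \<open>Naturality of the map \<open>u l \<tau>\<close> moves the identity of
      \<open>[l]\<close> to \<open>\<phi>\<close>; naturality of \<open>u\<close> itself then
      absorbs \<open>\<phi>\<close> into \<open>\<tau>\<close>.\<close>
    have "act X k l \<phi> (uncurry_map u l z) = u l \<tau> k (act A k l \<phi> x, \<phi>)"
      using natural_mapD(2)[OF sset_hom_natural[OF u'[OF \<tau>]] \<phi>, of "(x, \<lambda>i\<in>{..l}. i)"] x \<phi>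
      by (simp add: uncurry_map_def compose_ord_maps_id)
    also have "\<dots> = uncurry_map u k (act A k l \<phi> x, compose {..k} \<tau> \<phi>)"
      using A.act_closed[OF \<phi> x] by (rule sset_hom_map_sset_eq_uncurry[OF K u \<tau> _ \<phi>])
    finally show "uncurry_map u k (act (sset_prod A (\<Delta>[n]\<lparr>cells := K\<rparr>)) k l \<phi> z) =
        act X k l \<phi> (uncurry_map u l z)" by simp
  }
qed

section \<open>Restriction between mapping complexes\<close>

lemma map_precomp_apply:
  assumes "f \<in> sset_hom (sset_prod B \<Delta>[n]) X"
  shows "map_precomp (B\<lparr>cells := L\<rparr>) B X (sset_incl (B\<lparr>cells := L\<rparr>)) n f l (x, \<rho>) =
    (if x \<in> L l \<and> \<rho> \<in> ord_maps l n then f l (x, \<rho>) else undefined)"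
  using assms
  by (auto simp: map_precomp_def sset_comp_def compose_def sset_prod_map_def sset_incl_def)

lemma map_precomp_in_hom:
  "map_precomp (B\<lparr>cells := L\<rparr>) B X (sset_incl (B\<lparr>cells := L\<rparr>)) \<in>
    sset_hom (map_sset B X) (map_sset (B\<lparr>cells := L\<rparr>) X)" (is "?p \<in> _")
proof -
  note A = simplicial_set_subcomplex[OF B L]
  interpret M: simplicial_set "map_sset B X" using B by (rule simplicial_set_map_sset)
  have closed: "?p n f \<in> sset_hom (sset_prod (B\<lparr>cells := L\<rparr>) \<Delta>[n]) X"
    if f: "f \<in> sset_hom (sset_prod B \<Delta>[n]) X" for n f
  proof -
    have *: "natural_map (sset_prod (B\<lparr>cells := L\<rparr>) \<Delta>[n]) X f"
      using natural_mapD[OF sset_hom_natural[OF f]] subcomplexD(1)[OF L]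
      by (auto simp: natural_map_def)
    have **: "?p n f = (\<lambda>l. restrict (f l) (cells (sset_prod (B\<lparr>cells := L\<rparr>) \<Delta>[n]) l))"
      using f by (auto simp: fun_eq_iff map_precomp_apply)
    show ?thesis
      unfolding **
      by (rule natural_restrict_sset_hom[OF * simplicial_set_prod[OF A simplicial_set_std_simplex]])
  qed
  have "natural_map (map_sset B X) (map_sset (B\<lparr>cells := L\<rparr>) X) ?p"
    unfolding natural_map_def
  proof (intro conjI allI ballI)
    fix n f assume "f \<in> cells (map_sset B X) n"
    then show "?p n f \<in> cells (map_sset (B\<lparr>cells := L\<rparr>) X) n" using closed by simp
  next
    fix m n \<theta> f assume \<theta>: "\<theta> \<in> ord_maps m n" and f: "f \<in> cells (map_sset B X) n"
    show "?p m (act (map_sset B X) m n \<theta> f) = act (map_sset (B\<lparr>cells := L\<rparr>) X) m n \<theta> (?p n f)"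
    proof (intro ext)
      fix l z
      show "?p m (act (map_sset B X) m n \<theta> f) l z =
          act (map_sset (B\<lparr>cells := L\<rparr>) X) m n \<theta> (?p n f) l z"
        using \<theta> f M.act_closed[OF \<theta> f] subcomplexD(1)[OF L]
        by (cases z) (auto simp: map_precomp_apply act_map_sset ord_maps_compose)
    qed
  qed
  from natural_restrict_sset_hom[OF this M.simplicial_set_axioms]
  have "(\<lambda>n. restrict (?p n) (cells (map_sset B X) n)) \<in>
    sset_hom (map_sset B X) (map_sset (B\<lparr>cells := L\<rparr>) X)" .
  then show ?thesis by (simp add: map_precomp_def)
qed

text \<open>The domain of the pushout-product, as a family of cells of
  \<open>B \<times> \<Delta>[n]\<close>.\<close>

definition corner :: "(nat \<Rightarrow> (nat \<Rightarrow> nat) set) \<Rightarrow> nat \<Rightarrow> nat \<Rightarrow> ('a \<times> (nat \<Rightarrow> nat)) set" where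
  "corner K n m = {(x, \<tau>). x \<in> cells B m \<and> \<tau> \<in> ord_maps m n \<and> (x \<in> L m \<or> \<tau> \<in> K m)}"

lemma subcomplex_corner:
  assumes "subcomplex \<Delta>[n] K"
  shows "subcomplex (sset_prod B \<Delta>[n]) (corner K n)"
  using subcomplexD[OF assms] subcomplexD[OF L] simplicial_set.act_closed[OF B]
  unfolding subcomplex_def corner_def by (auto simp: ord_maps_compose)

text \<open>In a lifting square, \<open>u\<close> uncurries to a map on \<open>B \<times> K\<close>
  and \<open>v\<close> to a map on \<open>L \<times> \<Delta>[n]\<close>. Commutativity makes them
  agree on \<open>L \<times> K\<close>, so they glue to a map on the corner; an extension of it
  curries to the lift.\<close>

lemma has_rlp_if_extendable:
  assumes K: "subcomplex \<Delta>[n] K"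
    and ex: "extendable X (sset_prod B \<Delta>[n]) (corner K n) (cells (sset_prod B \<Delta>[n]))"
  shows "has_rlp (\<Delta>[n]\<lparr>cells := K\<rparr>) \<Delta>[n] (sset_incl (\<Delta>[n]\<lparr>cells := K\<rparr>))
    (map_sset B X) (map_sset (B\<lparr>cells := L\<rparr>) X)
    (map_precomp (B\<lparr>cells := L\<rparr>) B X (sset_incl (B\<lparr>cells := L\<rparr>)))"
  unfolding has_rlp_def
proof (intro ballI impI)
  let ?p = "map_precomp (B\<lparr>cells := L\<rparr>) B X (sset_incl (B\<lparr>cells := L\<rparr>))"
  let ?K = "\<Delta>[n]\<lparr>cells := K\<rparr>"
  note A = simplicial_set_subcomplex[OF B L]
  fix u v
  assume u: "u \<in> sset_hom ?K (map_sset B X)"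
    and v: "v \<in> sset_hom \<Delta>[n] (map_sset (B\<lparr>cells := L\<rparr>) X)"
    and uv: "sset_comp ?K ?p u = sset_comp ?K v (sset_incl ?K)"
  have v': "v \<in> sset_hom (\<Delta>[n]\<lparr>cells := cells \<Delta>[n]\<rparr>) (map_sset (B\<lparr>cells := L\<rparr>) X)"
    using v by simp
  note full = subcomplex_cells[OF simplicial_set_std_simplex]
  note KD = subcomplexD[OF K]
  have u': "u m \<tau> \<in> sset_hom (sset_prod B \<Delta>[m]) X" if "\<tau> \<in> K m" for m \<tau>
    using natural_mapD(1)[OF sset_hom_natural[OF u]] that by simp
  \<comment> \<open>The square is evaluated at \<open>\<tau>\<close> and then at \<open>x\<close>
    paired with the identity of \<open>[m]\<close>.\<close>
  have compat: "uncurry_map u m (x, \<tau>) = uncurry_map v m (x, \<tau>)" if "x \<in> L m" "\<tau> \<in> K m" for m x \<tau>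
    using fun_cong[OF fun_cong[OF fun_cong[OF fun_cong[OF uv, of m], of \<tau>], of m],
        of "(x, \<lambda>i\<in>{..m}. i)"] that u'
    by (simp add: uncurry_map_def sset_comp_apply sset_incl_apply map_precomp_apply)
  define f where "f m z = (if snd z \<in> K m then uncurry_map u m z else uncurry_map v m z)" for m z
  have f1: "f m (x, \<tau>) = uncurry_map u m (x, \<tau>)" if "\<tau> \<in> K m" for m x \<tau>
    using that by (simp add: f_def)
  have f2: "f m (x, \<tau>) = uncurry_map v m (x, \<tau>)" if "x \<in> L m" for m x \<tau>
    using that compat by (simp add: f_def)
  note uD = natural_mapD[OF uncurry_map_natural[OF B K u]]
  note vD = natural_mapD[OF uncurry_map_natural[OF A full v']]
  have "natural_map ((sset_prod B \<Delta>[n])\<lparr>cells := corner K n\<rparr>) X f"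
    unfolding natural_map_def
  proof (intro conjI allI ballI)
    fix m z assume "z \<in> cells ((sset_prod B \<Delta>[n])\<lparr>cells := corner K n\<rparr>) m"
    then show "f m z \<in> cells X m"
      using uD(1) vD(1) by (auto simp: corner_def f1 f2)
  next
    fix l m \<theta> z assume \<theta>: "\<theta> \<in> ord_maps l m"
      and "z \<in> cells ((sset_prod B \<Delta>[n])\<lparr>cells := corner K n\<rparr>) m"
    then obtain x \<tau> where [simp]: "z = (x, \<tau>)" and x: "x \<in> cells B m" and \<tau>: "\<tau> \<in> ord_maps m n"
      and "x \<in> L m \<or> \<tau> \<in> K m"
      by (auto simp: corner_def)
    then consider "\<tau> \<in> K m" | "x \<in> L m" by blast
    then show "f l (act ((sset_prod B \<Delta>[n])\<lparr>cells := corner K n\<rparr>) l m \<theta> z) = act X l m \<theta> (f m z)"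
    proof cases
      case 1
      then show ?thesis using uD(2)[OF \<theta>, of "(x, \<tau>)"] KD(2)[OF \<theta> 1] x by (simp add: f1)
    next
      case 2
      then show ?thesis using vD(2)[OF \<theta>, of "(x, \<tau>)"] subcomplexD(2)[OF L \<theta> 2] \<tau> by (simp add: f2)
    qed
  qed
  then obtain g where g: "natural_map (sset_prod B \<Delta>[n]) X g"
    and gf: "\<And>m z. z \<in> corner K n m \<Longrightarrow> g m z = f m z"
    using ex unfolding extendable_def by auto
  define w where "w = (\<lambda>m. restrict (curry_map B g m) (cells \<Delta>[n] m))"
  have w: "w \<in> sset_hom \<Delta>[n] (map_sset B X)"
    unfolding w_def using curry_map_natural[OF B full, of n g] g by simp
  have w': "w m \<tau> \<in> sset_hom (sset_prod B \<Delta>[m]) X" if "\<tau> \<in> ord_maps m n" for m \<tau>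
    using natural_mapD(1)[OF sset_hom_natural[OF w]] that by simp
  \<comment> \<open>Each triangle is an equality of functions at all arguments; those outside the
    cells, where both sides are \<open>undefined\<close>, form separate cases.\<close>
  have "sset_comp ?K w (sset_incl ?K) = u"
  proof (intro ext)
    fix m \<tau> l and z :: "'a \<times> (nat \<Rightarrow> nat)"
    obtain x \<rho> where [simp]: "z = (x, \<rho>)" by fastforce
    show "sset_comp ?K w (sset_incl ?K) m \<tau> l z = u m \<tau> l z"
    proof (cases "\<tau> \<in> K m")
      case True
      then have 1: "\<tau> \<in> ord_maps m n" using KD(1) by fastforce
      show ?thesis
      proof (cases "x \<in> cells B l \<and> \<rho> \<in> ord_maps l m")
        case in_cells: True
        have 2: "compose {..l} \<tau> \<rho> \<in> K l" using in_cells KD(2)[OF _ True, of \<rho> l] by simp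
        then show ?thesis
          using True 1 in_cells gf[of "(x, compose {..l} \<tau> \<rho>)" l]
          by (simp add: sset_comp_apply sset_incl_apply w_def curry_map_def f1
              corner_def ord_maps_compose[OF _ 1] sset_hom_map_sset_eq_uncurry[OF K u True])
      next
        case False
        then show ?thesis
          using True 1 sset_hom_undefined[OF u'[OF True], of z l]
          by (auto simp: sset_comp_apply sset_incl_apply w_def curry_map_def)
      qed
    next
      case False
      then show ?thesis
        using sset_hom_undefined[OF u, of \<tau> m] by (simp add: sset_comp_apply)
    qed
  qed
  moreover have "sset_comp \<Delta>[n] ?p w = v"
  proof (intro ext)
    fix m \<tau> l and z :: "'a \<times> (nat \<Rightarrow> nat)"
    obtain x \<rho> where [simp]: "z = (x, \<rho>)" by fastforce
    show "sset_comp \<Delta>[n] ?p w m \<tau> l z = v m \<tau> l z"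
    proof (cases "\<tau> \<in> ord_maps m n")
      case True
      have v'': "v m \<tau> \<in> sset_hom (sset_prod (B\<lparr>cells := L\<rparr>) \<Delta>[m]) X"
        using natural_mapD(1)[OF sset_hom_natural[OF v]] True by simp
      have eq: "sset_comp \<Delta>[n] ?p w m \<tau> l z =
          (if x \<in> L l \<and> \<rho> \<in> ord_maps l m then w m \<tau> l (x, \<rho>) else undefined)"
        using True map_precomp_apply[OF w'[OF True]] by (simp add: sset_comp_apply)
      show ?thesis
      proof (cases "x \<in> L l \<and> \<rho> \<in> ord_maps l m")
        case in_cells: True
        then show ?thesis
          using True gf[of "(x, compose {..l} \<tau> \<rho>)" l] subcomplexD(1)[OF L, of x l]
          unfolding eq
          by (simp add: w_def curry_map_def f2 corner_def ord_maps_compose[OF _ True]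
              sset_hom_map_sset_eq_uncurry[OF full v'])
      next
        case False
        then show ?thesis
          using sset_hom_undefined[OF v'', of z l] unfolding eq by auto
      qed
    next
      case False
      then show ?thesis
        using sset_hom_undefined[OF v, of \<tau> m] by (simp add: sset_comp_apply)
    qed
  qed
  ultimately show "\<exists>w\<in>sset_hom \<Delta>[n] (map_sset B X).
      sset_comp ?K w (sset_incl ?K) = u \<and> sset_comp \<Delta>[n] ?p w = v"
    using w by blast
qed

text \<open>The restrictions of \<open>f\<close> to \<open>B \<times> K\<close> and to
  \<open>L \<times> \<Delta>[n]\<close> curry to a lifting square, and the lift uncurries to the
  extension. The upper triangle gives agreement on the first piece, the lower triangle on the
  second.\<close>

lemma extendable_if_has_rlp:
  assumes K: "subcomplex \<Delta>[n] K"
    and rlp: "has_rlp (\<Delta>[n]\<lparr>cells := K\<rparr>) \<Delta>[n] (sset_incl (\<Delta>[n]\<lparr>cells := K\<rparr>))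
      (map_sset B X) (map_sset (B\<lparr>cells := L\<rparr>) X)
      (map_precomp (B\<lparr>cells := L\<rparr>) B X (sset_incl (B\<lparr>cells := L\<rparr>)))"
  shows "extendable X (sset_prod B \<Delta>[n]) (corner K n) (cells (sset_prod B \<Delta>[n]))"
  unfolding extendable_def
proof (intro allI impI)
  let ?p = "map_precomp (B\<lparr>cells := L\<rparr>) B X (sset_incl (B\<lparr>cells := L\<rparr>))"
  let ?K = "\<Delta>[n]\<lparr>cells := K\<rparr>"
  note A = simplicial_set_subcomplex[OF B L]
  note full = subcomplex_cells[OF simplicial_set_std_simplex]
  note KD = subcomplexD[OF K]
  fix f assume "natural_map ((sset_prod B \<Delta>[n])\<lparr>cells := corner K n\<rparr>) X f"
  note fD = natural_mapD[OF this, simplified]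
  have fK: "natural_map (sset_prod B ?K) X f"
    using KD(1) fD by (auto simp: natural_map_def corner_def)
  have fL: "natural_map (sset_prod (B\<lparr>cells := L\<rparr>) \<Delta>[n]) X f"
    using subcomplexD(1)[OF L] fD by (auto simp: natural_map_def corner_def)
  define u where "u = (\<lambda>m. restrict (curry_map B f m) (K m))"
  define v where "v = (\<lambda>m. restrict (curry_map (B\<lparr>cells := L\<rparr>) f m) (cells \<Delta>[n] m))"
  have u: "u \<in> sset_hom ?K (map_sset B X)"
    unfolding u_def by (rule curry_map_natural[OF B K fK])
  have v: "v \<in> sset_hom \<Delta>[n] (map_sset (B\<lparr>cells := L\<rparr>) X)"
    unfolding v_def using curry_map_natural[OF A full, of n f] fL by simp
  have "sset_comp ?K ?p u = sset_comp ?K v (sset_incl ?K)"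
  proof (intro ext)
    fix m \<tau> l and z :: "'a \<times> (nat \<Rightarrow> nat)"
    show "sset_comp ?K ?p u m \<tau> l z = sset_comp ?K v (sset_incl ?K) m \<tau> l z"
      using KD(1)[of \<tau> m] subcomplexD(1)[OF L] curry_map_in_hom[OF B K fK, of \<tau> m]
      by (cases z) (auto simp: sset_comp_apply sset_incl_apply u_def v_def
          map_precomp_apply curry_map_def)
  qed
  then obtain w where w: "w \<in> sset_hom \<Delta>[n] (map_sset B X)"
    and wu: "sset_comp ?K w (sset_incl ?K) = u" and wv: "sset_comp \<Delta>[n] ?p w = v"
    using rlp u v unfolding has_rlp_def by blast
  have w': "w m \<tau> \<in> sset_hom (sset_prod B \<Delta>[m]) X" if "\<tau> \<in> ord_maps m n" for m \<tau>
    using natural_mapD(1)[OF sset_hom_natural[OF w]] that by simp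
  have "natural_map (sset_prod B \<Delta>[n]) X (uncurry_map w)"
    using uncurry_map_natural[OF B full, of w n] w by simp
  moreover have "uncurry_map w m (x, \<tau>) = f m (x, \<tau>)"
    if x: "x \<in> cells B m" and \<tau>: "\<tau> \<in> ord_maps m n" and "x \<in> L m \<or> \<tau> \<in> K m" for m x \<tau>
  proof -
    from that(3) consider "\<tau> \<in> K m" | "x \<in> L m" by blast
    then show ?thesis
    proof cases
      case 1
      then have "w m \<tau> = u m \<tau>"
        using fun_cong[OF fun_cong[OF wu, of m], of \<tau>]
        by (simp add: sset_comp_apply sset_incl_apply)
      then show ?thesis
        using 1 x \<tau> by (simp add: uncurry_map_def u_def curry_map_def compose_ord_maps_id)
    next
      case 2
      have "?p m (w m \<tau>) m (x, \<lambda>i\<in>{..m}. i) = v m \<tau> m (x, \<lambda>i\<in>{..m}. i)"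
        using fun_cong[OF fun_cong[OF wv, of m], of \<tau>] \<tau> by (simp add: sset_comp_apply)
      then show ?thesis
        using 2 \<tau> map_precomp_apply[OF w'[OF \<tau>]]
        by (simp add: uncurry_map_def v_def curry_map_def compose_ord_maps_id)
    qed
  qed
  ultimately show "\<exists>g. natural_map ((sset_prod B \<Delta>[n])\<lparr>cells := cells (sset_prod B \<Delta>[n])\<rparr>) X g \<and>
      (\<forall>m. \<forall>z\<in>corner K n m. g m z = f m z)"
    by (intro exI[of _ "uncurry_map w"]) (auto simp: corner_def)
qed

end

section \<open>Subcomplexes of a standard simplex\<close>

lemma faces_union_eq:
  "faces_union n S = \<Delta>[n]\<lparr>cells := \<lambda>m. {\<tau> \<in> ord_maps m n. \<exists>l\<in>S. l \<notin> \<tau> ` {..m}}\<rparr>"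
  unfolding faces_union_def face_def by (rule arg_cong[where f = "\<lambda>K. \<Delta>[n]\<lparr>cells := K\<rparr>"]) auto

lemma cells_faces_union:
  "cells (faces_union n S) m = {\<tau> \<in> ord_maps m n. \<exists>l\<in>S. l \<notin> \<tau> ` {..m}}"
  by (simp add: faces_union_eq)

lemma faces_union_update: "\<Delta>[n]\<lparr>cells := cells (faces_union n S)\<rparr> = faces_union n S"
  by (simp add: faces_union_eq)

lemma subcomplex_faces_union: "subcomplex \<Delta>[n] (cells (faces_union n S))"
  unfolding subcomplex_def cells_faces_union
proof (intro conjI allI ballI)
  fix m k \<theta> \<tau>
  assume \<theta>: "\<theta> \<in> ord_maps m k" and "\<tau> \<in> {\<tau> \<in> ord_maps k n. \<exists>l\<in>S. l \<notin> \<tau> ` {..k}}"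
  then obtain l where l: "l \<in> S" "l \<notin> \<tau> ` {..k}" and \<tau>: "\<tau> \<in> ord_maps k n" by auto
  have "l \<notin> compose {..m} \<tau> \<theta> ` {..m}"
    using l(2) ord_mapsD(1)[OF \<theta>] by (auto simp: compose_def)
  then show "act \<Delta>[n] m k \<theta> \<tau> \<in> {\<tau> \<in> ord_maps m n. \<exists>l\<in>S. l \<notin> \<tau> ` {..m}}"
    using \<theta> \<tau> l(1) by (auto simp: ord_maps_compose)
qed auto

section \<open>Faces as images of simplices\<close>

lemma ord_maps_image:
  assumes "\<tau> \<in> ord_maps m n"
  shows "\<tau> ` {..m} \<subseteq> {..n}" and "\<tau> ` {..m} \<noteq> {}"
  using ord_mapsD(1)[OF assms] by auto

lemma image_compose: "compose A g f ` A = g ` f ` A"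
  by (auto simp: compose_def)

text \<open>The increasing enumeration of \<open>T\<close> presents the face spanned by
  \<open>T\<close> as the injective image of a simplex of dimension
  \<open>card T - 1\<close>.\<close>

lemma ex_ord_map_onto:
  assumes "T \<subseteq> {..n}" and "T \<noteq> {}"
  obtains k e where "e \<in> ord_maps k n" "e ` {..k} = T" "inj_on e {..k}"
proof -
  have fin: "finite T" using assms(1) finite_subset by auto
  obtain h where h: "bij_betw h {..<card T} T" "strict_mono_on {..<card T} h"
    using ex_bij_betw_strict_mono_card[OF fin] .
  obtain k where k: "card T = Suc k" using assms(2) fin by (metis card_eq_0_iff not0_implies_Suc)
  have [simp]: "{..<card T} = {..k}" by (auto simp: k)
  have "restrict h {..k} \<in> ord_maps k n"
  proof (rule ord_maps_restrictI)
    show "h i \<le> n" if "i \<le> k" for i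
      using that h(1) assms(1) by (auto simp: bij_betw_def)
    show "h i \<le> h j" if "i \<le> j" "j \<le> k" for i j
      using h(2) that by (cases "i = j") (auto simp: strict_mono_on_def intro: less_imp_le)
  qed
  moreover have "restrict h {..k} ` {..k} = T" "inj_on (restrict h {..k}) {..k}"
    using h(1) by (auto simp: bij_betw_def)
  ultimately show thesis using that by blast
qed

text \<open>An injective monotone map reflects the order, so its pointwise inverse is monotone on
  the image. Hence every simplex with vertices in a face comes from the simplex that parametrizes
  the face.\<close>

lemma ord_maps_factor:
  assumes e: "e \<in> ord_maps k n" "inj_on e {..k}"
    and \<tau>: "\<tau> \<in> ord_maps m n" "\<tau> ` {..m} \<subseteq> e ` {..k}"
  obtains \<tau>' where "\<tau>' \<in> ord_maps m k" "\<tau> = compose {..m} e \<tau>'"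
proof
  define \<tau>' where "\<tau>' = (\<lambda>i\<in>{..m}. inv_into {..k} e (\<tau> i))"
  have *: "inv_into {..k} e (\<tau> i) \<le> k" "e (inv_into {..k} e (\<tau> i)) = \<tau> i" if "i \<le> m" for i
  proof -
    have "\<tau> i \<in> e ` {..k}" using that \<tau>(2) by auto
    then show "inv_into {..k} e (\<tau> i) \<le> k" "e (inv_into {..k} e (\<tau> i)) = \<tau> i"
      using inv_into_into[of "\<tau> i" e "{..k}"] f_inv_into_f[of "\<tau> i" e "{..k}"] by auto
  qed
  show \<tau>': "\<tau>' \<in> ord_maps m k"
    unfolding \<tau>'_def
  proof (rule ord_maps_restrictI)
    fix i j assume ij: "i \<le> j" "j \<le> m"
    show "inv_into {..k} e (\<tau> i) \<le> inv_into {..k} e (\<tau> j)" (is "?a \<le> ?b")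
    proof (rule ccontr)
      assume "\<not> ?a \<le> ?b"
      then have "e ?b \<le> e ?a" using ord_mapsD(2)[OF e(1), of ?b ?a] *[of i] ij by simp
      then have "e ?a = e ?b" using ord_mapsD(2)[OF \<tau>(1)] ij *[of i] *[of j]
        by (metis le_antisym le_trans)
      then show False
        using e(2) * ij \<open>\<not> ?a \<le> ?b\<close> by (metis le_trans order_refl)
    qed
  qed (use * in auto)
  show "\<tau> = compose {..m} e \<tau>'"
    using * by (intro ord_maps_eqI[OF \<tau>(1) ord_maps_compose[OF \<tau>' e(1)]])
      (auto simp: compose_def \<tau>'_def)
qed

lemma compose_inj_on:
  assumes "inj_on e {..k}" and "\<sigma> \<in> ord_maps m k" and "\<tau> \<in> ord_maps m k"
    and "compose {..m} e \<sigma> = compose {..m} e \<tau>"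
  shows "\<sigma> = \<tau>"
proof (rule ord_maps_eqI[OF assms(2,3)])
  fix i assume i: "i \<le> m"
  then have "e (\<sigma> i) = e (\<tau> i)" using fun_cong[OF assms(4), of i] by (simp add: compose_def)
  then show "\<sigma> i = \<tau> i"
    using assms(1) ord_mapsD(1)[OF assms(2) i] ord_mapsD(1)[OF assms(3) i] by (auto dest: inj_onD)
qed

text \<open>The faces of an abstract simplicial complex; the empty set is excluded because simplices
  have nonempty vertex sets.\<close>

definition down_closed :: "'b set set \<Rightarrow> bool" where
  "down_closed \<F> \<longleftrightarrow> {} \<notin> \<F> \<and> (\<forall>S\<in>\<F>. \<forall>T\<subseteq>S. T \<noteq> {} \<longrightarrow> T \<in> \<F>)"

text \<open>A nondegenerate simplex of \<open>\<Delta>[n]\<close> is determined by its vertex set,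
  so down-closed families encode the subcomplexes of \<open>\<Delta>[n]\<close>.\<close>

definition face_family :: "nat \<Rightarrow> nat set set \<Rightarrow> nat \<Rightarrow> (nat \<Rightarrow> nat) set" where
  "face_family n \<F> m = {\<tau> \<in> ord_maps m n. \<tau> ` {..m} \<in> \<F>}"

lemma subcomplex_face_family:
  assumes "down_closed \<F>"
  shows "subcomplex \<Delta>[n] (face_family n \<F>)"
  unfolding subcomplex_def face_family_def
proof (intro conjI allI ballI)
  fix m k \<theta> \<tau>
  assume \<theta>: "\<theta> \<in> ord_maps m k" and \<tau>: "\<tau> \<in> {\<tau> \<in> ord_maps k n. \<tau> ` {..k} \<in> \<F>}"
  then have "compose {..m} \<tau> \<theta> ` {..m} \<subseteq> \<tau> ` {..k}"
    using ord_mapsD(1)[OF \<theta>] by (auto simp: compose_def)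
  then show "act \<Delta>[n] m k \<theta> \<tau> \<in> {\<tau> \<in> ord_maps m n. \<tau> ` {..m} \<in> \<F>}"
    using \<theta> \<tau> assms by (auto simp: ord_maps_compose down_closed_def)
qed auto

context pushout_corner
begin

text \<open>Missing faces are attached one at a time. A missing \<open>T\<close> of least size has
  its whole boundary in \<open>\<F>\<close>, so adding it is a pushout of the corner for
  \<open>\<partial>\<Delta>[k]\<close>, where \<open>T\<close> has \<open>k + 1\<close>
  elements.\<close>

lemma extendable_corner_face_family:
  assumes bd: "\<And>k. extendable X (sset_prod B \<Delta>[k]) (corner (cells \<partial>\<Delta>[k]) k) (cells (sset_prod B \<Delta>[k]))"
    and "\<F> \<subseteq> Pow {..n}" and "down_closed \<F>"
  shows "extendable X (sset_prod B \<Delta>[n]) (corner (face_family n \<F>) n) (cells (sset_prod B \<Delta>[n]))"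
  using assms(2,3)
proof (induction "card (Pow {..n} - {{}} - \<F>)" arbitrary: \<F> rule: less_induct)
  case less
  let ?Z = "sset_prod B \<Delta>[n]"
  show ?case
  proof (cases "Pow {..n} - {{}} \<subseteq> \<F>")
    case True
    then have "\<tau> ` {..m} \<in> \<F>" if "\<tau> \<in> ord_maps m n" for \<tau> m
      using ord_maps_image[OF that] by blast
    then have "corner (face_family n \<F>) n = cells ?Z"
      by (auto simp: fun_eq_iff corner_def face_family_def)
    then show ?thesis by (simp add: extendable_refl)
  next
    case False
    then obtain T0 where "T0 \<in> Pow {..n} - {{}} - \<F>" by blast
    then obtain T where T: "T \<in> Pow {..n} - {{}} - \<F>"
      and least: "\<And>S. S \<in> Pow {..n} - {{}} - \<F> \<Longrightarrow> card T \<le> card S"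
      using ex_has_least_nat[of "\<lambda>T. T \<in> Pow {..n} - {{}} - \<F>" T0 card] by blast
    have T': "T \<subseteq> {..n}" "T \<noteq> {}" using T by auto
    have finT: "finite T" using T finite_subset by auto
    have proper: "S \<in> \<F>" if "S \<subset> T" "S \<noteq> {}" for S
      using least[of S] psubset_card_mono[OF finT that(1)] that T by (auto simp: subset_iff)
    obtain k e where e: "e \<in> ord_maps k n" "e ` {..k} = T" "inj_on e {..k}"
      using ex_ord_map_onto[OF T'] .
    define s where "s m = (\<lambda>(x :: 'a, \<tau>). (x, compose {..m} e \<tau>))" for m :: nat
    have s: "natural_map (sset_prod B \<Delta>[k]) ?Z s"
      unfolding natural_map_def s_def
      using e(1) by (auto simp: ord_maps_compose compose_ord_maps_assoc)
    have inj: "inj_on (s m) (cells (sset_prod B \<Delta>[k]) m)" for m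
      using compose_inj_on[OF e(3)] by (auto simp: s_def inj_on_def)
    \<comment> \<open>The preimage of \<open>\<F>\<close> under \<open>e\<close> is the boundary:
      proper nonempty subsets of \<open>T\<close> belong to \<open>\<F>\<close>, and
      \<open>T\<close> itself does not.\<close>
    have img: "compose {..m} e \<tau> ` {..m} \<in> \<F> \<longleftrightarrow> (\<exists>l\<in>{..k}. l \<notin> \<tau> ` {..m})"
      if \<tau>: "\<tau> \<in> ord_maps m k" for m \<tau>
    proof -
      have eq: "compose {..m} e \<tau> ` {..m} = e ` \<tau> ` {..m}" by (rule image_compose)
      show ?thesis
      proof (cases "\<tau> ` {..m} = {..k}")
        case True
        then show ?thesis using T e(2) unfolding eq by auto
      next
        case False
        then have sub: "\<tau> ` {..m} \<subset> {..k}" using ord_maps_image[OF \<tau>] by auto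
        then have "e ` \<tau> ` {..m} \<subset> T"
          unfolding e(2)[symmetric] by (rule image_strict_mono[OF e(3)])
        then have "e ` \<tau> ` {..m} \<in> \<F>" using proper by simp
        moreover have "\<exists>l\<in>{..k}. l \<notin> \<tau> ` {..m}" using sub by auto
        ultimately show ?thesis unfolding eq by blast
      qed
    qed
    have "(\<lambda>m. {b \<in> cells (sset_prod B \<Delta>[k]) m. s m b \<in> corner (face_family n \<F>) n m}) =
        corner (cells \<partial>\<Delta>[k]) k"
    proof (rule ext, rule set_eqI)
      fix m and z :: "'a \<times> (nat \<Rightarrow> nat)"
      show "z \<in> {b \<in> cells (sset_prod B \<Delta>[k]) m. s m b \<in> corner (face_family n \<F>) n m} \<longleftrightarrow>
          z \<in> corner (cells \<partial>\<Delta>[k]) k m"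
        using e(1) by (cases z) (simp add: corner_def face_family_def s_def img ord_maps_compose
            simplex_boundary_def cells_faces_union cong: conj_cong)
    qed
    moreover have "(\<lambda>m. corner (face_family n \<F>) n m \<union> s m ` cells (sset_prod B \<Delta>[k]) m) =
        corner (face_family n (insert T \<F>)) n"
    proof (rule ext, rule set_eqI, clarify)
      fix m x \<tau>
      show "(x, \<tau>) \<in> corner (face_family n \<F>) n m \<union> s m ` cells (sset_prod B \<Delta>[k]) m \<longleftrightarrow>
          (x, \<tau>) \<in> corner (face_family n (insert T \<F>)) n m" (is "?l \<longleftrightarrow> ?r")
      proof
        assume ?l
        moreover have "(x, \<tau>) \<in> corner (face_family n (insert T \<F>)) n m"
          if x: "x \<in> cells B m" and \<tau>': "\<tau>' \<in> ord_maps m k" "\<tau> = compose {..m} e \<tau>'" for \<tau>'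
        proof -
          have "\<tau> ` {..m} \<subseteq> T" "\<tau> ` {..m} \<noteq> {}"
            using \<tau>' e(2) ord_maps_image[OF \<tau>'(1)] unfolding \<tau>'(2) image_compose by auto
          then have "\<tau> ` {..m} \<in> insert T \<F>" using proper by blast
          then show ?thesis
            using x \<tau>' e(1) by (simp add: corner_def face_family_def ord_maps_compose)
        qed
        ultimately show ?r by (auto simp: s_def) (auto simp: corner_def face_family_def)
      next
        assume r: ?r
        show ?l
        proof (cases "\<tau> ` {..m} = T")
          case True
          moreover have "x \<in> cells B m" "\<tau> \<in> ord_maps m n" using r by (auto simp: corner_def)
          ultimately obtain \<tau>' where "\<tau>' \<in> ord_maps m k" "\<tau> = compose {..m} e \<tau>'"
            using ord_maps_factor[OF e(1,3), of \<tau> m] e(2) by auto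
          then have "(x, \<tau>) = s m (x, \<tau>')" "(x, \<tau>') \<in> cells (sset_prod B \<Delta>[k]) m"
            using \<open>x \<in> cells B m\<close> by (auto simp: s_def)
          then show ?thesis by blast
        next
          case False
          then show ?thesis using r by (auto simp: corner_def face_family_def)
        qed
      qed
    qed
    ultimately have step: "extendable X ?Z (corner (face_family n \<F>) n)
        (corner (face_family n (insert T \<F>)) n)"
      using extendable_pushout[OF subcomplex_corner[OF subcomplex_face_family[OF less.prems(2)]] s inj
          simplicial_set_prod[OF B simplicial_set_std_simplex], of X] bd[of k]
      by simp
    have dc: "down_closed (insert T \<F>)"
      using less.prems(2) T proper unfolding down_closed_def by (auto simp: psubset_eq)
    have "card (Pow {..n} - {{}} - insert T \<F>) < card (Pow {..n} - {{}} - \<F>)"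
      using T by (intro psubset_card_mono) auto
    then have "extendable X ?Z (corner (face_family n (insert T \<F>)) n) (cells ?Z)"
      using less.hyps dc T less.prems(1) by blast
    with step show ?thesis
      by (rule extendable_trans) (auto simp: corner_def face_family_def)
  qed
qed

end

text \<open>The section is \<open>\<tau> \<mapsto> (t \<circ> \<tau>, \<tau>)\<close>, and \<open>R\<close> induces the retraction.\<close>

lemma extendable_retract:
  assumes X: "simplicial_set X" and L: "subcomplex \<Delta>[a] L" and K: "subcomplex \<Delta>[n] K"
    and extn: "extendable X (sset_prod \<Delta>[a] \<Delta>[n]) (pushout_corner.corner \<Delta>[a] L K n)
      (cells (sset_prod \<Delta>[a] \<Delta>[n]))"
    and t: "t \<in> ord_maps n a"
    and R_le: "\<And>x y. x \<le> a \<Longrightarrow> y \<le> n \<Longrightarrow> R x y \<le> n"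
    and R_mono: "\<And>x y x' y'. x \<le> x' \<Longrightarrow> y \<le> y' \<Longrightarrow> x' \<le> a \<Longrightarrow> y' \<le> n \<Longrightarrow> R x y \<le> R x' y'"
    and R_t: "\<And>y. y \<le> n \<Longrightarrow> R (t y) y = y"
    and R_K: "\<And>m \<sigma> \<tau>. \<sigma> \<in> ord_maps m a \<Longrightarrow> \<tau> \<in> ord_maps m n \<Longrightarrow> \<sigma> \<in> L m \<or> \<tau> \<in> K m \<Longrightarrow>
      (\<lambda>i\<in>{..m}. R (\<sigma> i) (\<tau> i)) \<in> K m"
  shows "extendable X \<Delta>[n] K (cells \<Delta>[n])"
  unfolding extendable_def
proof (intro allI impI)
  interpret pushout_corner X "\<Delta>[a]" L
    by (intro pushout_corner.intro X L simplicial_set_std_simplex)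
  fix f assume f: "natural_map (\<Delta>[n]\<lparr>cells := K\<rparr>) X f"
  note fD = natural_mapD[OF f, simplified]
  note cornerD = subcomplexD[OF subcomplex_corner[OF K]]
  define r where "r m = (\<lambda>(\<sigma>, \<tau>). \<lambda>i\<in>{..m}. R (\<sigma> i) (\<tau> i))" for m :: nat
  have r: "r m z \<in> K m" if "z \<in> corner K n m" for m z
    using that R_K by (auto simp: corner_def r_def)
  \<comment> \<open>The given map is pulled back along the retraction, which sends the corner into
    \<open>K\<close> by \<open>R_K\<close>.\<close>
  have "natural_map ((sset_prod \<Delta>[a] \<Delta>[n])\<lparr>cells := corner K n\<rparr>) X (\<lambda>m z. f m (r m z))"
    unfolding natural_map_def
  proof (intro conjI allI ballI)
    fix m z assume "z \<in> cells ((sset_prod \<Delta>[a] \<Delta>[n])\<lparr>cells := corner K n\<rparr>) m"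
    then show "f m (r m z) \<in> cells X m" using r fD(1) by simp
  next
    fix l m \<theta> z assume \<theta>: "\<theta> \<in> ord_maps l m"
      and z: "z \<in> cells ((sset_prod \<Delta>[a] \<Delta>[n])\<lparr>cells := corner K n\<rparr>) m"
    have "r l (act (sset_prod \<Delta>[a] \<Delta>[n]) l m \<theta> z) = compose {..l} (r m z) \<theta>"
      using ord_mapsD(1)[OF \<theta>] by (cases z) (auto simp: r_def compose_def fun_eq_iff)
    then show "f l (r l (act ((sset_prod \<Delta>[a] \<Delta>[n])\<lparr>cells := corner K n\<rparr>) l m \<theta> z)) =
        act X l m \<theta> (f m (r m z))"
      using fD(2)[OF \<theta> r] z by simp
  qed
  then obtain g where g: "natural_map (sset_prod \<Delta>[a] \<Delta>[n]) X g"
    and gf: "\<And>m z. z \<in> corner K n m \<Longrightarrow> g m z = f m (r m z)"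
    using extn unfolding extendable_def by auto
  \<comment> \<open>The extension \<open>g\<close> is restricted along the section, which the
    retraction undoes by \<open>R_t\<close>.\<close>
  have "natural_map \<Delta>[n] X (\<lambda>m \<tau>. g m (compose {..m} t \<tau>, \<tau>))"
    unfolding natural_map_def
  proof (intro conjI allI ballI)
    fix m \<tau> assume "\<tau> \<in> cells \<Delta>[n] m"
    then show "g m (compose {..m} t \<tau>, \<tau>) \<in> cells X m"
      using natural_mapD(1)[OF g] t by (simp add: ord_maps_compose)
  next
    fix l m \<theta> \<tau> assume \<theta>: "\<theta> \<in> ord_maps l m" and \<tau>: "\<tau> \<in> cells \<Delta>[n] m"
    then have "(compose {..m} t \<tau>, \<tau>) \<in> cells (sset_prod \<Delta>[a] \<Delta>[n]) m"
      using t by (simp add: ord_maps_compose)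
    from natural_mapD(2)[OF g \<theta> this]
    show "g l (compose {..l} t (act \<Delta>[n] l m \<theta> \<tau>), act \<Delta>[n] l m \<theta> \<tau>) =
        act X l m \<theta> (g m (compose {..m} t \<tau>, \<tau>))"
      using \<theta> by (simp add: compose_ord_maps_assoc)
  qed
  moreover have "g m (compose {..m} t \<tau>, \<tau>) = f m \<tau>" if "\<tau> \<in> K m" for m \<tau>
  proof -
    have \<tau>: "\<tau> \<in> ord_maps m n" using subcomplexD(1)[OF K that] by simp
    have "r m (compose {..m} t \<tau>, \<tau>) = \<tau>"
      using ord_mapsD[OF \<tau>] R_t by (auto simp: r_def compose_def fun_eq_iff)
    moreover have "(compose {..m} t \<tau>, \<tau>) \<in> corner K n m"
      using that \<tau> t by (simp add: corner_def ord_maps_compose)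
    ultimately show ?thesis by (simp add: gf)
  qed
  ultimately show "\<exists>g. natural_map (\<Delta>[n]\<lparr>cells := cells \<Delta>[n]\<rparr>) X g \<and> (\<forall>m. \<forall>\<tau>\<in>K m. g m \<tau> = f m \<tau>)"
    by (intro exI[of _ "\<lambda>m \<tau>. g m (compose {..m} t \<tau>, \<tau>)"]) simp
qed

section \<open>2-Segal horns as retracts of corner inclusions\<close>

lemma segal_horn_commute: "\<Lambda>\<^sup>2[i,j;n] = \<Lambda>\<^sup>2[j,i;n]"
  by (simp add: segal_horn_def insert_commute)

lemma cells_segal_horn:
  "cells \<Lambda>\<^sup>2[i,j;n] m = {\<tau> \<in> ord_maps m n. \<exists>l\<in>{..n} - {i, j}. l \<notin> \<tau> ` {..m}}"
  unfolding segal_horn_def by (rule cells_faces_union)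

lemma segal_horn_update: "\<Delta>[n]\<lparr>cells := cells \<Lambda>\<^sup>2[i,j;n]\<rparr> = \<Lambda>\<^sup>2[i,j;n]"
  unfolding segal_horn_def by (rule faces_union_update)

lemma subcomplex_segal_horn: "subcomplex \<Delta>[n] (cells \<Lambda>\<^sup>2[i,j;n])"
  unfolding segal_horn_def by (rule subcomplex_faces_union)

lemma boundary_update: "\<Delta>[n]\<lparr>cells := cells \<partial>\<Delta>[n]\<rparr> = \<partial>\<Delta>[n]"
  unfolding simplex_boundary_def by (rule faces_union_update)

lemma subcomplex_boundary: "subcomplex \<Delta>[n] (cells \<partial>\<Delta>[n])"
  unfolding simplex_boundary_def by (rule subcomplex_faces_union)

lemma pushout_corner_segal_horn: "simplicial_set X \<Longrightarrow> pushout_corner X \<Delta>[n] (cells \<Lambda>\<^sup>2[i,j;n])"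
  by (intro pushout_corner.intro simplicial_set_std_simplex subcomplex_segal_horn)

text \<open>Puts the horn in the form required by
  \<open>extendable_corner_face_family\<close>.\<close>

lemma segal_horn_face_family:
  "cells \<Lambda>\<^sup>2[i,j;n] = face_family n {T. T \<noteq> {} \<and> T \<subseteq> {..n} \<and> \<not> {..n} - {i, j} \<subseteq> T}"
proof (rule ext)
  fix m
  show "cells \<Lambda>\<^sup>2[i,j;n] m = face_family n {T. T \<noteq> {} \<and> T \<subseteq> {..n} \<and> \<not> {..n} - {i, j} \<subseteq> T} m"
    unfolding cells_segal_horn face_family_def using ord_maps_image by blast
qed

text \<open>The adjunction applied to the boundary inclusions. The other clauses of
  \<open>trivial_fibration\<close> hold for every simplicial set \<open>X\<close>.\<close>

lemma trivial_fibration_iff_extendable: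
  assumes X: "simplicial_set X"
  shows "trivial_fibration (map_sset \<Delta>[a] X) (map_sset \<Lambda>\<^sup>2[i,j;a] X)
      (map_precomp \<Lambda>\<^sup>2[i,j;a] \<Delta>[a] X (sset_incl \<Lambda>\<^sup>2[i,j;a])) \<longleftrightarrow>
    (\<forall>n. extendable X (sset_prod \<Delta>[a] \<Delta>[n])
      (pushout_corner.corner \<Delta>[a] (cells \<Lambda>\<^sup>2[i,j;a]) (cells \<partial>\<Delta>[n]) n)
      (cells (sset_prod \<Delta>[a] \<Delta>[n])))"
proof -
  interpret pushout_corner X "\<Delta>[a]" "cells \<Lambda>\<^sup>2[i,j;a]"
    using X by (rule pushout_corner_segal_horn)
  have "simplicial_set (map_sset \<Delta>[a] X)" "simplicial_set (map_sset \<Lambda>\<^sup>2[i,j;a] X)"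
    using simplicial_set_map_sset[OF B]
      simplicial_set_map_sset[OF simplicial_set_subcomplex[OF B L]] by (simp_all add: segal_horn_update)
  then show ?thesis
    unfolding trivial_fibration_def
    using map_precomp_in_hom has_rlp_if_extendable[OF subcomplex_boundary]
      extendable_if_has_rlp[OF subcomplex_boundary]
    unfolding boundary_update segal_horn_update by blast
qed

text \<open>
  The retractions \<open>R x\<close> take values \<open>y\<close>, \<open>i\<close>, \<open>j\<close>, so they preserve faces of the horn. Once a
  value \<open>x\<close> not in the pair defining the horn in \<open>\<Delta>[3]\<close> is left out, they miss \<open>i + 1\<close> or an
  endpoint of \<open>{0, \<dots>, n}\<close>.
\<close>

lemma extendable_segal_horn:
  assumes X: "simplicial_set X"
    and ex02: "\<And>k. extendable X (sset_prod \<Delta>[3] \<Delta>[k])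
      (pushout_corner.corner \<Delta>[3] (cells \<Lambda>\<^sup>2[0,2;3]) (cells \<partial>\<Delta>[k]) k) (cells (sset_prod \<Delta>[3] \<Delta>[k]))"
    and ex13: "\<And>k. extendable X (sset_prod \<Delta>[3] \<Delta>[k])
      (pushout_corner.corner \<Delta>[3] (cells \<Lambda>\<^sup>2[1,3;3]) (cells \<partial>\<Delta>[k]) k) (cells (sset_prod \<Delta>[3] \<Delta>[k]))"
    and ij: "i + 2 \<le> j" "j \<le> n" "0 < i \<or> j < n"
  shows "extendable X \<Delta>[n] (cells \<Lambda>\<^sup>2[i,j;n]) (cells \<Delta>[n])"
proof -
  have dc: "down_closed {T. T \<noteq> {} \<and> T \<subseteq> {..n} \<and> \<not> {..n} - {i, j} \<subseteq> T}"
    unfolding down_closed_def by blast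
  have corner: "extendable X (sset_prod \<Delta>[3] \<Delta>[n])
      (pushout_corner.corner \<Delta>[3] (cells \<Lambda>\<^sup>2[p,q;3]) (cells \<Lambda>\<^sup>2[i,j;n]) n)
      (cells (sset_prod \<Delta>[3] \<Delta>[n]))"
    if "\<And>k. extendable X (sset_prod \<Delta>[3] \<Delta>[k])
      (pushout_corner.corner \<Delta>[3] (cells \<Lambda>\<^sup>2[p,q;3]) (cells \<partial>\<Delta>[k]) k) (cells (sset_prod \<Delta>[3] \<Delta>[k]))" for p q
    unfolding segal_horn_face_family[of i j n]
    by (rule pushout_corner.extendable_corner_face_family[OF pushout_corner_segal_horn[OF X] that _ dc]) auto
  \<comment> \<open>If \<open>\<sigma>\<close> misses \<open>d\<close>, then \<open>miss\<close>
    supplies a missed vertex. If \<open>\<tau>\<close> misses some \<open>l\<close> other than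
    \<open>i\<close> and \<open>j\<close>, so does the image, whose vertices are \<open>i\<close>,
    \<open>j\<close> or vertices of \<open>\<tau>\<close>.\<close>
  have horn: "(\<lambda>p\<in>{..m}. R (\<sigma> p) (\<tau> p)) \<in> cells \<Lambda>\<^sup>2[i,j;n] m"
    if \<sigma>: "\<sigma> \<in> ord_maps m 3" and \<tau>: "\<tau> \<in> ord_maps m n"
      and \<sigma>\<tau>: "\<sigma> \<in> cells \<Lambda>\<^sup>2[c,c';3] m \<or> \<tau> \<in> cells \<Lambda>\<^sup>2[i,j;n] m"
      and le: "\<And>x y. x \<le> 3 \<Longrightarrow> y \<le> n \<Longrightarrow> R x y \<le> n"
      and mono: "\<And>x y x' y'. x \<le> x' \<Longrightarrow> y \<le> y' \<Longrightarrow> x' \<le> 3 \<Longrightarrow> y' \<le> n \<Longrightarrow> R x y \<le> R x' y'"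
      and R: "\<And>x y. R x y \<in> {y, i, j}"
      and miss: "\<And>d. d \<in> {..3} - {c, c'} \<Longrightarrow>
        \<exists>l\<in>{..n} - {i, j}. \<forall>x\<le>3. \<forall>y\<le>n. x \<noteq> d \<longrightarrow> R x y \<noteq> l"
    for m \<sigma> \<tau> c c' and R :: "nat \<Rightarrow> nat \<Rightarrow> nat"
  proof -
    have "\<exists>l\<in>{..n} - {i, j}. \<forall>p\<le>m. R (\<sigma> p) (\<tau> p) \<noteq> l" (is "\<exists>l\<in>?S. ?P l")
      using \<sigma>\<tau>
    proof
      assume "\<sigma> \<in> cells \<Lambda>\<^sup>2[c,c';3] m"
      then obtain d where d: "d \<in> {..3} - {c, c'}" "\<And>p. p \<le> m \<Longrightarrow> \<sigma> p \<noteq> d"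
        unfolding cells_segal_horn by fastforce
      then show ?thesis using miss[OF d(1)] ord_mapsD(1)[OF \<sigma>] ord_mapsD(1)[OF \<tau>] by meson
    next
      assume "\<tau> \<in> cells \<Lambda>\<^sup>2[i,j;n] m"
      then obtain l where l: "l \<in> {..n} - {i, j}" "\<And>p. p \<le> m \<Longrightarrow> \<tau> p \<noteq> l"
        unfolding cells_segal_horn by fastforce
      have "R (\<sigma> p) (\<tau> p) \<noteq> l" if "p \<le> m" for p
        using R[of "\<sigma> p" "\<tau> p"] l(1) l(2)[OF that] by auto
      with l(1) show ?thesis by blast
    qed
    then obtain l where "l \<in> ?S" "?P l" by blast
    moreover then have "l \<notin> (\<lambda>p\<in>{..m}. R (\<sigma> p) (\<tau> p)) ` {..m}" by auto
    moreover have "(\<lambda>p\<in>{..m}. R (\<sigma> p) (\<tau> p)) \<in> ord_maps m n"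
      using ord_mapsD[OF \<sigma>] ord_mapsD[OF \<tau>] le mono by (intro ord_maps_restrictI) auto
    ultimately show ?thesis unfolding cells_segal_horn by blast
  qed
  note retract = extendable_retract[OF X subcomplex_segal_horn subcomplex_segal_horn]
  consider "j < n" | "0 < i" using ij(3) by blast
  then show ?thesis
  proof cases
    case 1
    \<comment> \<open>\<open>t\<close> assigns to each \<open>y\<close> a row whose map fixes
      \<open>y\<close>. Without row 1 all values are at most \<open>i\<close> or at least
      \<open>j\<close>, so \<open>i + 1\<close> is missed; without row 3 all values are at most
      \<open>j < n\<close>, so \<open>n\<close> is missed.\<close>
    define R where "R x y = (if x = 0 then min y i else if x = 1 then min y j
      else if x = 2 then j else max y j)" for x y :: nat
    define t where "t = (\<lambda>y\<in>{..n}. if y \<le> i then 0 else if y < j then 1 else if y = j then 2 else 3 :: nat)"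
    have t: "t \<in> ord_maps n 3"
      unfolding t_def using ij by (intro ord_maps_restrictI) auto
    have le: "R x y \<le> n" if "y \<le> n" for x y
      using that ij by (auto simp: R_def)
    have mono: "R x y \<le> R x' y'" if "x \<le> x'" "y \<le> y'" for x y x' y'
      using that ij by (auto simp: R_def min_def max_def)
    have Rt: "R (t y) y = y" if "y \<le> n" for y
      using that ij by (auto simp: R_def t_def)
    have R: "R x y \<in> {y, i, j}" for x y
      by (auto simp: R_def min_def max_def)
    have miss: "\<exists>l\<in>{..n} - {i, j}. \<forall>x\<le>3. \<forall>y\<le>n. x \<noteq> d \<longrightarrow> R x y \<noteq> l"
      if "d \<in> {..3} - {0, 2}" for d
    proof -
      from that consider "d = 1" | "d = 3" by fastforce
      then show ?thesis
      proof cases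
        case 1
        then show ?thesis using ij by (intro bexI[of _ "i + 1"]) (auto simp: R_def)
      next
        case 2
        then show ?thesis using ij \<open>j < n\<close> by (intro bexI[of _ n]) (auto simp: R_def)
      qed
    qed
    have horn': "(\<lambda>p\<in>{..m}. R (\<sigma> p) (\<tau> p)) \<in> cells \<Lambda>\<^sup>2[i,j;n] m"
      if "\<sigma> \<in> ord_maps m 3" "\<tau> \<in> ord_maps m n"
        "\<sigma> \<in> cells \<Lambda>\<^sup>2[0,2;3] m \<or> \<tau> \<in> cells \<Lambda>\<^sup>2[i,j;n] m" for m \<sigma> \<tau>
      by (rule horn[OF that le mono R miss])
    show ?thesis
      by (rule retract[where R = R, OF corner[OF ex02] t le mono Rt horn'])
  next
    case 2
    \<comment> \<open>The dual choice. Without row 0 all values are at least \<open>i > 0\<close>,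
      so \<open>0\<close> is missed; without row 2 all values are at most \<open>i\<close> or at
      least \<open>j\<close>, so \<open>i + 1\<close> is missed.\<close>
    define R where "R x y = (if x = 0 then min y i else if x = 1 then i
      else if x = 2 then max y i else max y j)" for x y :: nat
    define t where "t = (\<lambda>y\<in>{..n}. if y < i then 0 else if y = i then 1 else if y < j then 2 else 3 :: nat)"
    have t: "t \<in> ord_maps n 3"
      unfolding t_def using ij by (intro ord_maps_restrictI) auto
    have le: "R x y \<le> n" if "y \<le> n" for x y
      using that ij by (auto simp: R_def)
    have mono: "R x y \<le> R x' y'" if "x \<le> x'" "y \<le> y'" for x y x' y'
      using that ij by (auto simp: R_def min_def max_def)
    have Rt: "R (t y) y = y" if "y \<le> n" for y
      using that ij by (auto simp: R_def t_def)
    have R: "R x y \<in> {y, i, j}" for x y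
      by (auto simp: R_def min_def max_def)
    have miss: "\<exists>l\<in>{..n} - {i, j}. \<forall>x\<le>3. \<forall>y\<le>n. x \<noteq> d \<longrightarrow> R x y \<noteq> l"
      if "d \<in> {..3} - {1, 3}" for d
    proof -
      from that consider "d = 0" | "d = 2" by fastforce
      then show ?thesis
      proof cases
        case 1
        then show ?thesis using ij \<open>0 < i\<close> by (intro bexI[of _ 0]) (auto simp: R_def)
      next
        case 2
        then show ?thesis using ij by (intro bexI[of _ "i + 1"]) (auto simp: R_def)
      qed
    qed
    have horn': "(\<lambda>p\<in>{..m}. R (\<sigma> p) (\<tau> p)) \<in> cells \<Lambda>\<^sup>2[i,j;n] m"
      if "\<sigma> \<in> ord_maps m 3" "\<tau> \<in> ord_maps m n"
        "\<sigma> \<in> cells \<Lambda>\<^sup>2[1,3;3] m \<or> \<tau> \<in> cells \<Lambda>\<^sup>2[i,j;n] m" for m \<sigma> \<tau>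
      by (rule horn[OF that le mono R miss])
    show ?thesis
      by (rule retract[where R = R, OF corner[OF ex13] t le mono Rt horn'])
  qed
qed

text \<open>A broken pair is a diagonal of the polygon with vertices \<open>0, ..., n\<close>: one
  vertex lies strictly between \<open>i\<close> and \<open>j\<close>, another before
  \<open>i\<close> or after \<open>j\<close>.\<close>

lemma broken_pairD:
  assumes "broken n {i, j}" and "i < j"
  shows "i + 2 \<le> j" "j \<le> n" "0 < i \<or> j < n"
  using assms by (auto simp: broken_def)

lemma quasi_2_segal_iff_extendable:
  assumes X: "simplicial_set X"
  shows "quasi_2_segal X \<longleftrightarrow> (\<forall>n\<ge>3. \<forall>i j. i \<noteq> j \<and> broken n {i, j} \<longrightarrow>
    extendable X \<Delta>[n] (cells \<Lambda>\<^sup>2[i,j;n]) (cells \<Delta>[n]))"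
  unfolding quasi_2_segal_def
    extendable_iff_sset_hom[OF simplicial_set_std_simplex subcomplex_segal_horn] segal_horn_update
  using X by blast

section \<open>Chains in the grid\<close>

definition pair_le :: "nat \<times> nat \<Rightarrow> nat \<times> nat \<Rightarrow> bool" (infix \<open>\<preceq>\<close> 50) where
  "p \<preceq> q \<longleftrightarrow> fst p \<le> fst q \<and> snd p \<le> snd q"

text \<open>The vertex sets of the nondegenerate simplices of
  \<open>\<Delta>[3] \<times> \<Delta>[n]\<close>. Down-closed families of them encode subcomplexes
  of the product, via \<open>chain_cells\<close>.\<close>

definition grid_chains :: "nat \<Rightarrow> (nat \<times> nat) set set" where
  "grid_chains n = {S. S \<subseteq> {..3} \<times> {..n} \<and> S \<noteq> {} \<and> (\<forall>p\<in>S. \<forall>q\<in>S. p \<preceq> q \<or> q \<preceq> p)}"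

definition chain_cells :: "nat \<Rightarrow> (nat \<times> nat) set set \<Rightarrow> nat \<Rightarrow> ((nat \<Rightarrow> nat) \<times> (nat \<Rightarrow> nat)) set" where
  "chain_cells n \<K> m =
    {(\<sigma>, \<tau>). \<sigma> \<in> ord_maps m 3 \<and> \<tau> \<in> ord_maps m n \<and> (\<lambda>i. (\<sigma> i, \<tau> i)) ` {..m} \<in> \<K>}"

lemma finite_grid_chains: "finite (grid_chains n)"
  by (rule finite_subset[of _ "Pow ({..3} \<times> {..n})"]) (auto simp: grid_chains_def)

lemma grid_chains_subset: "S \<in> grid_chains n \<Longrightarrow> T \<subseteq> S \<Longrightarrow> T \<noteq> {} \<Longrightarrow> T \<in> grid_chains n"
  unfolding grid_chains_def by blast

lemma image_in_grid_chains:
  assumes "\<sigma> \<in> ord_maps m 3" and "\<tau> \<in> ord_maps m n"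
  shows "(\<lambda>i. (\<sigma> i, \<tau> i)) ` {..m} \<in> grid_chains n"
proof -
  have "(\<sigma> i, \<tau> i) \<preceq> (\<sigma> j, \<tau> j) \<or> (\<sigma> j, \<tau> j) \<preceq> (\<sigma> i, \<tau> i)" if "i \<le> m" "j \<le> m" for i j
    using ord_mapsD(2)[OF assms(1)] ord_mapsD(2)[OF assms(2)] that
    by (cases "i \<le> j") (auto simp: pair_le_def)
  then show ?thesis
    using ord_mapsD(1)[OF assms(1)] ord_mapsD(1)[OF assms(2)] by (auto simp: grid_chains_def)
qed

lemma chain_cells_all: "chain_cells n (grid_chains n) = cells (sset_prod \<Delta>[3] \<Delta>[n])"
  by (auto simp: chain_cells_def fun_eq_iff image_in_grid_chains)

lemma subcomplex_chain_cells:
  assumes "down_closed \<K>"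
  shows "subcomplex (sset_prod \<Delta>[3] \<Delta>[n]) (chain_cells n \<K>)"
  unfolding subcomplex_def
proof (intro conjI allI ballI)
  fix m k \<theta> z assume \<theta>: "\<theta> \<in> ord_maps m k" and z: "z \<in> chain_cells n \<K> k"
  obtain \<sigma> \<tau> where [simp]: "z = (\<sigma>, \<tau>)" by fastforce
  have "(\<lambda>i. (compose {..m} \<sigma> \<theta> i, compose {..m} \<tau> \<theta> i)) ` {..m} \<subseteq> (\<lambda>i. (\<sigma> i, \<tau> i)) ` {..k}"
    using ord_mapsD(1)[OF \<theta>] by (auto simp: compose_def)
  then have "(\<lambda>i. (compose {..m} \<sigma> \<theta> i, compose {..m} \<tau> \<theta> i)) ` {..m} \<in> \<K>"
    using z assms unfolding chain_cells_def down_closed_def by auto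
  then show "act (sset_prod \<Delta>[3] \<Delta>[n]) m k \<theta> z \<in> chain_cells n \<K> m"
    using z \<theta> by (simp add: chain_cells_def ord_maps_compose)
qed (auto simp: chain_cells_def)

text \<open>On a chain the coordinate sum is injective, which turns chains into sets of naturals.\<close>

lemma inj_on_sum_chain:
  assumes "C \<in> grid_chains n"
  shows "inj_on (\<lambda>p. fst p + snd p) C"
proof (rule inj_onI)
  fix p q assume "p \<in> C" "q \<in> C" and eq: "fst p + snd p = fst q + snd q"
  then have "p \<preceq> q \<or> q \<preceq> p" using assms by (auto simp: grid_chains_def)
  with eq show "p = q" by (cases p; cases q) (auto simp: pair_le_def)
qed

text \<open>The coordinate sums of \<open>C\<close> are enumerated increasingly and lifted back to
  \<open>C\<close>. On a chain the order of the sums is the order of the points, so both coordinates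
  are monotone.\<close>

lemma ex_chain_enumeration:
  assumes C: "C \<in> grid_chains n"
  obtains k a b where "a \<in> ord_maps k 3" "b \<in> ord_maps k n"
    "inj_on (\<lambda>i. a i + b i) {..k}" "(\<lambda>i. (a i, b i)) ` {..k} = C"
proof -
  let ?key = "\<lambda>p :: nat \<times> nat. fst p + snd p"
  note inj = inj_on_sum_chain[OF C]
  have "?key p \<le> 3 + n" if "p \<in> C" for p
    using C that by (intro add_mono) (auto simp: grid_chains_def)
  then have key_le: "?key ` C \<subseteq> {..3 + n}" by auto
  have key_ne: "?key ` C \<noteq> {}" using C by (auto simp: grid_chains_def)
  obtain k e where e: "e \<in> ord_maps k (3 + n)" "e ` {..k} = ?key ` C" "inj_on e {..k}"
    using ex_ord_map_onto[OF key_le key_ne] .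
  define E where "E i = inv_into C ?key (e i)" for i
  have E: "E i \<in> C" "?key (E i) = e i" if "i \<le> k" for i
  proof -
    have "e i \<in> ?key ` C" using e(2) that by blast
    then show "E i \<in> C" "?key (E i) = e i"
      unfolding E_def by (rule inv_into_into, rule f_inv_into_f)
  qed
  have mono: "E i \<preceq> E j" if "i \<le> j" "j \<le> k" for i j
  proof -
    have "E i \<preceq> E j \<or> E j \<preceq> E i" using C E(1)[of i] E(1)[of j] that by (auto simp: grid_chains_def)
    moreover have "?key (E i) \<le> ?key (E j)"
      using ord_mapsD(2)[OF e(1) that] E(2)[of i] E(2)[of j] that by simp
    ultimately show ?thesis by (auto simp: pair_le_def)
  qed
  have grid: "fst (E i) \<le> 3" "snd (E i) \<le> n" if "i \<le> k" for i
    using C E(1)[OF that] by (auto simp: grid_chains_def)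
  show thesis
  proof (rule that)
    show "(\<lambda>i\<in>{..k}. fst (E i)) \<in> ord_maps k 3" "(\<lambda>i\<in>{..k}. snd (E i)) \<in> ord_maps k n"
      using grid mono by (auto intro!: ord_maps_restrictI simp: pair_le_def)
    show "inj_on (\<lambda>i. (\<lambda>i\<in>{..k}. fst (E i)) i + (\<lambda>i\<in>{..k}. snd (E i)) i) {..k}"
      using e(3) E(2) by (auto simp: inj_on_def)
    have "C \<subseteq> E ` {..k}"
    proof
      fix p assume p: "p \<in> C"
      then obtain i where i: "i \<le> k" "?key p = e i" using e(2) by blast
      then have "p = E i" using inj_onD[OF inj, of p "E i"] E[OF i(1)] p by simp
      then show "p \<in> E ` {..k}" using i(1) by simp
    qed
    then have "E ` {..k} = C" using E(1) by blast
    then show "(\<lambda>i. ((\<lambda>i\<in>{..k}. fst (E i)) i, (\<lambda>i\<in>{..k}. snd (E i)) i)) ` {..k} = C"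
      by simp
  qed
qed

text \<open>By \<open>faces\<close>, the simplex \<open>C\<close> meets the given subcomplex in the
  horn that leaves out the faces opposite \<open>v\<close> and \<open>w\<close>. The point
  \<open>x\<close> lies strictly between them and \<open>y\<close> lies outside, so their positions
  in \<open>C\<close> form a broken pair and attaching \<open>C\<close> is a pushout of a 2-Segal
  horn.\<close>

lemma extendable_attach_chain:
  assumes X: "simplicial_set X"
    and horns: "\<And>k i j. i \<noteq> j \<Longrightarrow> broken k {i, j} \<Longrightarrow> extendable X \<Delta>[k] (cells \<Lambda>\<^sup>2[i,j;k]) (cells \<Delta>[k])"
    and \<K>: "down_closed \<K>" and C: "C \<in> grid_chains n"
    and vw: "v \<in> C" "w \<in> C"
    and between: "x \<in> C" "v \<preceq> x" "v \<noteq> x" "x \<preceq> w" "x \<noteq> w"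
    and outside: "y \<in> C" "y \<preceq> v \<and> y \<noteq> v \<or> w \<preceq> y \<and> w \<noteq> y"
    and faces: "\<And>T. T \<subseteq> C \<Longrightarrow> T \<noteq> {} \<Longrightarrow> T \<in> \<K> \<longleftrightarrow> \<not> C - {v, w} \<subseteq> T"
  shows "extendable X (sset_prod \<Delta>[3] \<Delta>[n]) (chain_cells n \<K>)
    (chain_cells n (\<K> \<union> {T. T \<subseteq> C \<and> T \<noteq> {}}))"
proof -
  let ?Z = "sset_prod \<Delta>[3] \<Delta>[n]"
  obtain k a b where a: "a \<in> ord_maps k 3" and b: "b \<in> ord_maps k n"
    and inj_sum: "inj_on (\<lambda>i. a i + b i) {..k}" and onto: "(\<lambda>i. (a i, b i)) ` {..k} = C"
    using ex_chain_enumeration[OF C] .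
  define E where "E i = (a i, b i)" for i
  have onto: "E ` {..k} = C" unfolding E_def by (rule onto)
  have inj: "inj_on E {..k}" using inj_sum by (auto simp: inj_on_def E_def)
  have index_less: "i < j" if "E i \<preceq> E j" "E i \<noteq> E j" "i \<le> k" for i j
  proof (rule ccontr)
    assume "\<not> i < j"
    then have "E j \<preceq> E i"
      using ord_mapsD(2)[OF a] ord_mapsD(2)[OF b] that(3) by (auto simp: pair_le_def E_def)
    with that show False by (auto simp: pair_le_def E_def)
  qed
  obtain i j p q where idx: "i \<le> k" "E i = v" "j \<le> k" "E j = w" "p \<le> k" "E p = x" "q \<le> k" "E q = y"
    using vw between(1) outside(1) unfolding onto[symmetric] by auto
  have ipj: "i < p" "p < j" using index_less[of i p] index_less[of p j] idx between by auto
  have q: "q < i \<or> j < q" using index_less[of q i] index_less[of j q] idx outside by auto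
  have "broken k {i, j}"
    unfolding broken_def
  proof (intro conjI)
    show "3 \<le> k" "{i, j} \<subseteq> {..k}" using ipj q idx by auto
    show "\<exists>i' j' k' l. i' < j' \<and> j' < k' \<and> k' < l \<and> l \<le> k \<and>
        (i' \<in> {i, j} \<and> k' \<in> {i, j} \<and> j' \<notin> {i, j} \<and> l \<notin> {i, j} \<or>
         i' \<notin> {i, j} \<and> k' \<notin> {i, j} \<and> j' \<in> {i, j} \<and> l \<in> {i, j})"
      using q
    proof
      assume "q < i"
      then show ?thesis
        using ipj idx by (intro exI[of _ q] exI[of _ i] exI[of _ p] exI[of _ j]) auto
    next
      assume "j < q"
      then show ?thesis
        using ipj idx by (intro exI[of _ i] exI[of _ p] exI[of _ j] exI[of _ q]) auto
    qed
  qed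
  then have horn: "extendable X \<Delta>[k] (cells \<Lambda>\<^sup>2[i,j;k]) (cells \<Delta>[k])"
    using horns ipj by simp
  define s where "s m = (\<lambda>\<theta>. (compose {..m} a \<theta>, compose {..m} b \<theta>))" for m :: nat
  have s: "natural_map \<Delta>[k] ?Z s"
    unfolding natural_map_def s_def
    using a b by (auto simp: ord_maps_compose compose_ord_maps_assoc)
  have inj_s: "inj_on (s m) (cells \<Delta>[k] m)" for m
  proof (rule inj_onI)
    fix \<theta> \<phi> assume \<theta>: "\<theta> \<in> cells \<Delta>[k] m" and \<phi>: "\<phi> \<in> cells \<Delta>[k] m" and eq: "s m \<theta> = s m \<phi>"
    \<comment> \<open>Neither \<open>a\<close> nor \<open>b\<close> need be injective, but their sum
      is.\<close>
    have "compose {..m} (\<lambda>i. a i + b i) \<theta> = compose {..m} (\<lambda>i. a i + b i) \<phi>"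
      using eq by (auto simp: s_def compose_def fun_eq_iff) metis
    with inj_sum \<theta> \<phi> show "\<theta> = \<phi>" by (intro compose_inj_on) auto
  qed
  have supp: "(\<lambda>i. (compose {..m} a \<theta> i, compose {..m} b \<theta> i)) ` {..m} = E ` \<theta> ` {..m}"
    for m :: nat and \<theta>
    by (auto simp: compose_def E_def image_image)
  \<comment> \<open>The preimage of \<open>\<K>\<close> under the enumeration is the horn.\<close>
  have img: "E ` \<theta> ` {..m} \<in> \<K> \<longleftrightarrow> (\<exists>l\<in>{..k} - {i, j}. l \<notin> \<theta> ` {..m})" if \<theta>: "\<theta> \<in> ord_maps m k" for m \<theta>
  proof -
    have "E ` \<theta> ` {..m} \<in> \<K> \<longleftrightarrow> \<not> C - {v, w} \<subseteq> E ` \<theta> ` {..m}"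
      using ord_maps_image[OF \<theta>] onto by (intro faces) auto
    also have "C - {v, w} = E ` ({..k} - {i, j})"
      using onto idx inj by (auto simp: inj_on_def)
    also have "E ` ({..k} - {i, j}) \<subseteq> E ` \<theta> ` {..m} \<longleftrightarrow> {..k} - {i, j} \<subseteq> \<theta> ` {..m}"
      using inj_on_image_mem_iff[OF inj _ ord_maps_image(1)[OF \<theta>]] by blast
    finally show ?thesis by blast
  qed
  have "(\<lambda>m. {\<theta> \<in> cells \<Delta>[k] m. s m \<theta> \<in> chain_cells n \<K> m}) = cells \<Lambda>\<^sup>2[i,j;k]"
  proof (rule ext, rule set_eqI)
    fix m \<theta>
    show "\<theta> \<in> {\<theta> \<in> cells \<Delta>[k] m. s m \<theta> \<in> chain_cells n \<K> m} \<longleftrightarrow> \<theta> \<in> cells \<Lambda>\<^sup>2[i,j;k] m"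
      using a b by (simp add: chain_cells_def s_def supp img ord_maps_compose cells_segal_horn
          cong: conj_cong)
  qed
  moreover have "(\<lambda>m. chain_cells n \<K> m \<union> s m ` cells \<Delta>[k] m) =
      chain_cells n (\<K> \<union> {T. T \<subseteq> C \<and> T \<noteq> {}})"
  proof (rule ext, rule set_eqI)
    fix m and z :: "(nat \<Rightarrow> nat) \<times> (nat \<Rightarrow> nat)"
    obtain \<sigma> \<tau> where z: "z = (\<sigma>, \<tau>)" by fastforce
    show "z \<in> chain_cells n \<K> m \<union> s m ` cells \<Delta>[k] m \<longleftrightarrow>
        z \<in> chain_cells n (\<K> \<union> {T. T \<subseteq> C \<and> T \<noteq> {}}) m" (is "?l \<longleftrightarrow> ?r")
    proof
      assume l: ?l
      have new: "s m \<theta> \<in> chain_cells n (\<K> \<union> {T. T \<subseteq> C \<and> T \<noteq> {}}) m" if \<theta>: "\<theta> \<in> ord_maps m k" for \<theta>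
      proof -
        have "E ` \<theta> ` {..m} \<subseteq> C" "E ` \<theta> ` {..m} \<noteq> {}"
          using ord_maps_image[OF \<theta>] onto by auto
        then show ?thesis
          using \<theta> a b by (simp add: chain_cells_def s_def supp ord_maps_compose)
      qed
      show ?r
      proof (cases "z \<in> chain_cells n \<K> m")
        case True
        then show ?thesis unfolding chain_cells_def by auto
      next
        case False
        with l have "z \<in> s m ` ord_maps m k" by simp
        then show ?thesis using new by blast
      qed
    next
      assume r: ?r
      show ?l
      proof (cases "(\<lambda>i. (\<sigma> i, \<tau> i)) ` {..m} \<subseteq> C")
        case True
        have \<sigma>: "\<sigma> \<in> ord_maps m 3" and \<tau>: "\<tau> \<in> ord_maps m n"
          using r z by (auto simp: chain_cells_def)
        \<comment> \<open>To factor a simplex supported in \<open>C\<close> through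
          \<open>s\<close>, its coordinate sum is factored through that of the enumeration;
          injectivity of the sum on \<open>C\<close> then recovers both coordinates.\<close>
        let ?ab = "\<lambda>i\<in>{..k}. a i + b i" and ?\<sigma>\<tau> = "\<lambda>i\<in>{..m}. \<sigma> i + \<tau> i"
        have ab: "?ab \<in> ord_maps k (3 + n)"
          using ord_mapsD[OF a] ord_mapsD[OF b] by (intro ord_maps_restrictI add_mono) auto
        have \<sigma>\<tau>: "?\<sigma>\<tau> \<in> ord_maps m (3 + n)"
          using ord_mapsD[OF \<sigma>] ord_mapsD[OF \<tau>] by (intro ord_maps_restrictI add_mono) auto
        have inj_ab: "inj_on ?ab {..k}" using inj_sum by (simp add: inj_on_def)
        have "\<sigma> l + \<tau> l \<in> ?ab ` {..k}" if "l \<le> m" for l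
        proof -
          have "(\<sigma> l, \<tau> l) \<in> E ` {..k}" using True onto that by auto
          then show ?thesis by (auto simp: E_def)
        qed
        then have "?\<sigma>\<tau> ` {..m} \<subseteq> ?ab ` {..k}" by auto
        then obtain \<theta> where \<theta>: "\<theta> \<in> ord_maps m k" and eq: "?\<sigma>\<tau> = compose {..m} ?ab \<theta>"
          using ord_maps_factor[OF ab inj_ab \<sigma>\<tau>] by blast
        have "\<sigma> l = a (\<theta> l) \<and> \<tau> l = b (\<theta> l)" if l: "l \<le> m" for l
        proof -
          have "\<theta> l \<le> k" using ord_mapsD(1)[OF \<theta> l] .
          then have "E (\<theta> l) \<in> C" using onto by auto
          moreover have "(\<sigma> l, \<tau> l) \<in> C" using True l by auto
          moreover have "\<sigma> l + \<tau> l = a (\<theta> l) + b (\<theta> l)"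
            using fun_cong[OF eq, of l] l \<open>\<theta> l \<le> k\<close> by (simp add: compose_def)
          ultimately have "(\<sigma> l, \<tau> l) = E (\<theta> l)"
            using inj_onD[OF inj_on_sum_chain[OF C], of "(\<sigma> l, \<tau> l)" "E (\<theta> l)"]
            by (simp add: E_def)
          then show ?thesis by (simp add: E_def)
        qed
        then have "z = s m \<theta>"
          using ord_mapsD(3)[OF \<sigma>] ord_mapsD(3)[OF \<tau>]
          by (auto simp: z s_def compose_def fun_eq_iff)
        then show ?thesis using \<theta> by auto
      next
        case False
        then show ?thesis using r z by (auto simp: chain_cells_def)
      qed
    qed
  qed
  ultimately show ?thesis
    using extendable_pushout[OF subcomplex_chain_cells[OF \<K>] s inj_s simplicial_set_std_simplex, of X]
      horn by simp
qed

section \<open>Filling a corner by 2-Segal horns\<close>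

text \<open>Treats both horns at once: \<open>\<Lambda>\<^sup>2[e,e+2;3]\<close> is the union of the
  faces opposite \<open>e + 1\<close> and \<open>q\<close>. The vertex \<open>q\<close> is above the
  pair in the first case and below it in the second.\<close>

locale horn_shape =
  fixes e q :: nat
  assumes shape: "e = 0 \<and> q = 3 \<or> e = 1 \<and> q = 0"
begin

text \<open>The nondegenerate simplices outside the corner.\<close>

definition essential :: "nat \<Rightarrow> (nat \<times> nat) set \<Rightarrow> bool" where
  "essential n S \<longleftrightarrow> S \<in> grid_chains n \<and> snd ` S = {..n} \<and> e + 1 \<in> fst ` S \<and> q \<in> fst ` S"

definition row :: "(nat \<times> nat) set \<Rightarrow> nat set" where
  "row S = {c. (e + 1, c) \<in> S}"

definition low :: "(nat \<times> nat) set \<Rightarrow> nat \<times> nat" where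
  "low S = (e, Min (row S))"

definition high :: "(nat \<times> nat) set \<Rightarrow> nat \<times> nat" where
  "high S = (e + 2, Max (row S))"

text \<open>For an essential chain, the largest member of its quadruple; the others arise from it by
  dropping \<open>low S\<close>, \<open>high S\<close> or both.\<close>

definition fill :: "(nat \<times> nat) set \<Rightarrow> (nat \<times> nat) set" where
  "fill S = insert (low S) (insert (high S) S)"

section \<open>Quadruples of essential chains\<close>

lemma row_essential:
  assumes "essential n S"
  shows "finite (row S)" "row S \<noteq> {}" "row S \<subseteq> {..n}"
    "Min (row S) \<in> row S" "Max (row S) \<in> row S" "Min (row S) \<le> Max (row S)"
proof -
  show *: "row S \<subseteq> {..n}" and **: "row S \<noteq> {}"
    using assms by (auto simp: essential_def row_def grid_chains_def)
  show fin: "finite (row S)" using * finite_subset by blast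
  show "Min (row S) \<in> row S" "Max (row S) \<in> row S" "Min (row S) \<le> Max (row S)"
    using fin ** by (auto intro: Min_in Max_in Min_le)
qed

lemma row_fill: "row (fill S) = row S"
  by (auto simp: row_def fill_def low_def high_def)

text \<open>The points \<open>low C\<close> and \<open>high C\<close> lie outside row
  \<open>e + 1\<close>, so all members of a quadruple have the same row and hence the same
  \<open>low\<close> and \<open>high\<close>.\<close>

lemma row_cong:
  assumes "C - {low C, high C} \<subseteq> T" and "T \<subseteq> C"
  shows "row T = row C"
  using assms by (auto simp: row_def low_def high_def)

lemma low_high_cong: "row S = row T \<Longrightarrow> low S = low T \<and> high S = high T"
  by (simp add: low_def high_def)

lemma fill_fill: "fill (fill S) = fill S"
  using low_high_cong[OF row_fill[of S]] by (auto simp: fill_def)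

text \<open>\<open>low S\<close> lies directly below the first point of row \<open>e + 1\<close>, in
  the same column, and no point of \<open>S\<close> other than \<open>low S\<close> fits between
  them. So comparability with that first point yields comparability with \<open>low S\<close>;
  dually for \<open>high S\<close>.\<close>

lemma essential_fill:
  assumes S: "essential n S"
  shows "essential n (fill S)"
proof -
  note row = row_essential[OF S]
  have sub: "S \<subseteq> {..3} \<times> {..n}" and ch: "\<And>p p'. p \<in> S \<Longrightarrow> p' \<in> S \<Longrightarrow> p \<preceq> p' \<or> p' \<preceq> p"
    and cols: "snd ` S = {..n}" and rows: "e + 1 \<in> fst ` S" "q \<in> fst ` S"
    using S by (auto simp: essential_def grid_chains_def)
  have mid: "(e + 1, Min (row S)) \<in> S" "(e + 1, Max (row S)) \<in> S"
    using row(4,5) by (auto simp: row_def)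
  have low: "p \<preceq> low S \<or> low S \<preceq> p" if p: "p \<in> S" for p
  proof -
    have "Min (row S) \<le> snd p" if "fst p = e + 1"
      using p that row(1) by (cases p) (auto simp: row_def intro: Min_le)
    moreover have "p \<preceq> (e + 1, Min (row S)) \<or> (e + 1, Min (row S)) \<preceq> p" using ch p mid(1) by blast
    ultimately show ?thesis by (cases "fst p = e + 1") (auto simp: pair_le_def low_def)
  qed
  have high: "p \<preceq> high S \<or> high S \<preceq> p" if p: "p \<in> S" for p
  proof -
    have "snd p \<le> Max (row S)" if "fst p = e + 1"
      using p that row(1) by (cases p) (auto simp: row_def intro: Max_ge)
    moreover have "p \<preceq> (e + 1, Max (row S)) \<or> (e + 1, Max (row S)) \<preceq> p" using ch p mid(2) by blast
    ultimately show ?thesis by (cases "fst p = e + 1") (auto simp: pair_le_def high_def)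
  qed
  have lh: "low S \<preceq> high S" using row(6) by (simp add: pair_le_def low_def high_def)
  have grid: "low S \<in> {..3} \<times> {..n}" "high S \<in> {..3} \<times> {..n}"
    using shape row(3,4,5) by (auto simp: low_def high_def)
  have "p \<preceq> p' \<or> p' \<preceq> p" if "p \<in> fill S" "p' \<in> fill S" for p p'
  proof -
    have refl: "low S \<preceq> low S" "high S \<preceq> high S" by (simp_all add: pair_le_def)
    from that show ?thesis
      unfolding fill_def using ch low high lh refl by (elim insertE; blast)
  qed
  then have "fill S \<in> grid_chains n"
    using sub grid unfolding grid_chains_def by (auto simp: fill_def)
  moreover have "snd ` fill S = {..n}"
    using cols grid by (auto simp: fill_def)
  ultimately show ?thesis
    using rows by (auto simp: essential_def fill_def)
qed

text \<open>Dropping \<open>low C\<close> or \<open>high C\<close> uncovers no column, since each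
  shares its column with a point of row \<open>e + 1\<close>, and neither point lies in row
  \<open>e + 1\<close> or \<open>q\<close>.\<close>

lemma essential_between:
  assumes C: "essential n C" and full: "fill C = C" and T: "C - {low C, high C} \<subseteq> T" "T \<subseteq> C"
  shows "essential n T" and "fill T = C"
proof -
  note row = row_essential[OF C] and rT = row_cong[OF T]
  show "fill T = C"
    using low_high_cong[OF rT] T full by (auto simp: fill_def)
  have mid: "(e + 1, Min (row C)) \<in> T" "(e + 1, Max (row C)) \<in> T"
    using row(4,5) unfolding rT[symmetric] by (auto simp: row_def)
  have "T \<in> grid_chains n"
    using grid_chains_subset[OF _ T(2)] C mid by (auto simp: essential_def)
  moreover have "snd ` T = {..n}"
  proof
    show "snd ` T \<subseteq> {..n}" using C T(2) by (auto simp: essential_def)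
    show "{..n} \<subseteq> snd ` T"
    proof
      fix c assume "c \<in> {..n}"
      then have "c \<in> snd ` C" using C by (simp add: essential_def)
      then obtain p where p: "p \<in> C" "snd p = c" by blast
      show "c \<in> snd ` T"
      proof (cases "p \<in> {low C, high C}")
        case True
        then show ?thesis using p(2) mid by (force simp: low_def high_def)
      next
        case False
        then show ?thesis using p T(1) by auto
      qed
    qed
  qed
  moreover have "q \<in> fst ` T"
  proof -
    obtain p where p: "p \<in> C" "fst p = q" using C by (auto simp: essential_def)
    then have "p \<notin> {low C, high C}" using shape by (auto simp: low_def high_def)
    then show ?thesis using p T(1) by auto
  qed
  ultimately show "essential n T" using mid(1) by (force simp: essential_def)
qed

text \<open>If \<open>C - {u}\<close> is essential and the ends of its row \<open>e + 1\<close> are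
  unchanged, it is filled and smaller than \<open>C\<close>. Otherwise its row spans less, so its
  filling comes earlier in the order.\<close>

lemma remove_vertex_mem:
  assumes \<K>: "down_closed \<K>" and inessential: "\<And>S. S \<in> grid_chains n \<Longrightarrow> \<not> essential n S \<Longrightarrow> S \<in> \<K>"
    and C: "essential n C" "fill C = C"
    and minimal: "\<And>S. (S, C) \<in> measures [\<lambda>S. Max (row S) - Min (row S), card] \<Longrightarrow>
      essential n S \<Longrightarrow> fill S = S \<Longrightarrow> S \<in> \<K>"
    and u: "u \<in> C - {low C, high C}"
  shows "C - {u} \<in> \<K>"
proof -
  let ?S = "C - {u}"
  have lh: "low C \<in> ?S" "high C \<in> ?S" using u C(2) by (auto simp: fill_def)
  have S: "?S \<in> grid_chains n"
    using C(1) lh grid_chains_subset[of C n ?S] by (auto simp: essential_def)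
  show ?thesis
  proof (cases "essential n ?S")
    case True
    have finC: "finite C"
      using C(1) finite_subset[of C "{..3} \<times> {..n}"] by (auto simp: essential_def grid_chains_def)
    note rowC = row_essential[OF C(1)] and rowS = row_essential[OF True]
    have sub: "row ?S \<subseteq> row C" by (auto simp: row_def)
    have le: "Min (row C) \<le> Min (row ?S)" "Max (row ?S) \<le> Max (row C)"
      using sub rowC(1) rowS(2) by (auto intro: Min_antimono Max_mono)
    show ?thesis
    proof (cases "Min (row ?S) = Min (row C) \<and> Max (row ?S) = Max (row C)")
      case True
      then have "low ?S = low C" "high ?S = high C" by (simp_all add: low_def high_def)
      then have "fill ?S = ?S" using lh by (auto simp: fill_def)
      moreover have "card ?S < card C" using u finC by (intro psubset_card_mono) auto
      ultimately show ?thesis using minimal[of ?S] True \<open>essential n ?S\<close> by simp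
    next
      case False
      \<comment> \<open>Filling may restore the cardinality of \<open>C\<close>, which is why the
        span comes first in the measure.\<close>
      then have "Max (row ?S) - Min (row ?S) < Max (row C) - Min (row C)"
        using le rowS(6) by linarith
      then have "fill ?S \<in> \<K>"
        using minimal[of "fill ?S"] essential_fill[OF True] fill_fill by (simp add: row_fill)
      moreover have "?S \<subseteq> fill ?S" "?S \<noteq> {}" using lh by (auto simp: fill_def)
      ultimately show ?thesis using \<K> unfolding down_closed_def by blast
    qed
  next
    case False
    then show ?thesis using S inessential by blast
  qed
qed

text \<open>Induction on the number of missing chains. The last hypothesis, with down-closure, says
  that each quadruple lies entirely inside or entirely outside \<open>\<K>\<close>; each step
  attaches the quadruple of a minimal missing filled chain.\<close>

lemma extendable_chain_cells:
  assumes X: "simplicial_set X"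
    and horns: "\<And>k i j. i \<noteq> j \<Longrightarrow> broken k {i, j} \<Longrightarrow> extendable X \<Delta>[k] (cells \<Lambda>\<^sup>2[i,j;k]) (cells \<Delta>[k])"
    and "\<K> \<subseteq> grid_chains n" and "down_closed \<K>"
    and "\<And>S. S \<in> grid_chains n \<Longrightarrow> \<not> essential n S \<Longrightarrow> S \<in> \<K>"
    and "\<And>S. S \<in> \<K> \<Longrightarrow> essential n S \<Longrightarrow> fill S \<in> \<K>"
  shows "extendable X (sset_prod \<Delta>[3] \<Delta>[n]) (chain_cells n \<K>) (cells (sset_prod \<Delta>[3] \<Delta>[n]))"
  using assms(3-6)
proof (induction "card (grid_chains n - \<K>)" arbitrary: \<K> rule: less_induct)
  case less
  note \<K> = less.prems(2) and inessential = less.prems(3) and saturated = less.prems(4)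
  have closed: "T \<in> \<K>" if "S \<in> \<K>" "T \<subseteq> S" "T \<noteq> {}" for S T
    using \<K> that unfolding down_closed_def by blast
  show ?case
  proof (cases "grid_chains n \<subseteq> \<K>")
    case True
    then have "\<K> = grid_chains n" using less.prems(1) by blast
    then show ?thesis by (simp add: chain_cells_all extendable_refl)
  next
    case False
    define D where "D = {S. essential n S \<and> fill S = S \<and> S \<notin> \<K>}"
    from False obtain S0 where S0: "S0 \<in> grid_chains n" "S0 \<notin> \<K>" by blast
    then have "essential n S0" using inessential by blast
    moreover have "S0 \<subseteq> fill S0" "S0 \<noteq> {}" using S0(1) by (auto simp: fill_def grid_chains_def)
    ultimately have D0: "fill S0 \<in> D"
      using S0(2) closed essential_fill fill_fill unfolding D_def by blast
    obtain C where "C \<in> D"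
      and min: "\<And>S. (S, C) \<in> measures [\<lambda>S. Max (row S) - Min (row S), card] \<Longrightarrow> S \<notin> D"
      by (rule wfE_min[OF wf_measures[of "[\<lambda>S. Max (row S) - Min (row S), card]"] D0]) blast
    then have C: "essential n C" "fill C = C" "C \<notin> \<K>" by (auto simp: D_def)
    have C': "C \<in> grid_chains n" using C(1) by (simp add: essential_def)
    \<comment> \<open>Among the faces of \<open>C\<close> only its quadruple is missing: by
      saturation a member of it in \<open>\<K>\<close> would bring in \<open>C\<close>, and every
      other face avoids some vertex \<open>u\<close> whose removal lands in
      \<open>\<K>\<close>.\<close>
    have faces: "T \<in> \<K> \<longleftrightarrow> \<not> C - {low C, high C} \<subseteq> T" if T: "T \<subseteq> C" "T \<noteq> {}" for T
    proof
      assume "T \<in> \<K>"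
      show "\<not> C - {low C, high C} \<subseteq> T"
      proof
        assume "C - {low C, high C} \<subseteq> T"
        from essential_between[OF C(1,2) this T(1)] saturated[OF \<open>T \<in> \<K>\<close>] C(3) show False by simp
      qed
    next
      assume "\<not> C - {low C, high C} \<subseteq> T"
      then obtain u where u: "u \<in> C - {low C, high C}" "u \<notin> T" by blast
      have "C - {u} \<in> \<K>"
        using min by (intro remove_vertex_mem[OF \<K> inessential C(1,2) _ u(1)]) (auto simp: D_def)
      then show "T \<in> \<K>" using closed u(2) T by blast
    qed
    let ?K' = "\<K> \<union> {T. T \<subseteq> C \<and> T \<noteq> {}}"
    note row = row_essential[OF C(1)]
    \<comment> \<open>A point in row \<open>q\<close> lies above \<open>high C\<close> if
      \<open>q = 3\<close> and below \<open>low C\<close> if \<open>q = 0\<close>, so it serves as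
      the outer point.\<close>
    obtain y where y: "y \<in> C" "fst y = q" using C(1) by (auto simp: essential_def)
    have step: "extendable X (sset_prod \<Delta>[3] \<Delta>[n]) (chain_cells n \<K>) (chain_cells n ?K')"
    proof (rule extendable_attach_chain[OF X horns \<K> C' _ _ _ _ _ _ _ y(1) _ faces])
      show "low C \<in> C" "high C \<in> C" using C(2) by (auto simp: fill_def)
      then have "y \<preceq> low C \<or> low C \<preceq> y" "y \<preceq> high C \<or> high C \<preceq> y"
        using C' y(1) unfolding grid_chains_def by blast+
      then show "y \<preceq> low C \<and> y \<noteq> low C \<or> high C \<preceq> y \<and> high C \<noteq> y"
        using shape y(2) by (auto simp: pair_le_def low_def high_def)
      show "(e + 1, Min (row C)) \<in> C" using row(4) by (simp add: row_def)
      show "low C \<preceq> (e + 1, Min (row C))" "low C \<noteq> (e + 1, Min (row C))"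
        "(e + 1, Min (row C)) \<preceq> high C" "(e + 1, Min (row C)) \<noteq> high C"
        using row(6) by (auto simp: pair_le_def low_def high_def)
    qed
    have "extendable X (sset_prod \<Delta>[3] \<Delta>[n]) (chain_cells n ?K') (cells (sset_prod \<Delta>[3] \<Delta>[n]))"
    proof (rule less.hyps)
      show "card (grid_chains n - ?K') < card (grid_chains n - \<K>)"
      proof (rule psubset_card_mono)
        have "C \<noteq> {}" using C' by (auto simp: grid_chains_def)
        then show "grid_chains n - ?K' \<subset> grid_chains n - \<K>" using C' C(3) by blast
      qed (simp add: finite_grid_chains)
      show "?K' \<subseteq> grid_chains n" using less.prems(1) grid_chains_subset[OF C'] by blast
      show "down_closed ?K'" using \<K> unfolding down_closed_def by blast
      show "S \<in> ?K'" if "S \<in> grid_chains n" "\<not> essential n S" for S using inessential that by blast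
      \<comment> \<open>The only new chains are the quadruple of \<open>C\<close>, all with filling
        \<open>C\<close>, so saturation persists.\<close>
      show "fill S \<in> ?K'" if "S \<in> ?K'" "essential n S" for S
      proof (cases "S \<in> \<K>")
        case True
        then show ?thesis using saturated that(2) by blast
      next
        case False
        then have S: "S \<subseteq> C" "S \<noteq> {}" using that(1) by auto
        then have "C - {low C, high C} \<subseteq> S" using faces False by blast
        then have "fill S = C" using essential_between(2)[OF C(1,2) _ S(1)] by blast
        then show ?thesis using C' by (auto simp: grid_chains_def)
      qed
    qed
    with step show ?thesis
      by (rule extendable_trans) (auto simp: chain_cells_def)
  qed
qed

text \<open>A simplex lies in the corner iff its second coordinate is not onto \<open>[n]\<close> or
  its first misses \<open>e + 1\<close> or \<open>q\<close>, that is, iff its chain is inessential.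
  For this starting family saturation is vacuous.\<close>

lemma extendable_corner_boundary:
  assumes X: "simplicial_set X"
    and horns: "\<And>k i j. i \<noteq> j \<Longrightarrow> broken k {i, j} \<Longrightarrow> extendable X \<Delta>[k] (cells \<Lambda>\<^sup>2[i,j;k]) (cells \<Delta>[k])"
  shows "extendable X (sset_prod \<Delta>[3] \<Delta>[n])
    (pushout_corner.corner \<Delta>[3] (cells \<Lambda>\<^sup>2[e,e + 2;3]) (cells \<partial>\<Delta>[n]) n) (cells (sset_prod \<Delta>[3] \<Delta>[n]))"
proof -
  interpret pushout_corner X "\<Delta>[3]" "cells \<Lambda>\<^sup>2[e,e + 2;3]"
    using X by (rule pushout_corner_segal_horn)
  let ?K = "{S \<in> grid_chains n. \<not> essential n S}"
  have rows: "{..3} - {e, e + 2} = {e + 1, q}" using shape by auto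
  have "chain_cells n ?K = corner (cells \<partial>\<Delta>[n]) n"
  proof (rule ext, rule set_eqI)
    fix m and z :: "(nat \<Rightarrow> nat) \<times> (nat \<Rightarrow> nat)"
    obtain \<sigma> \<tau> where z: "z = (\<sigma>, \<tau>)" by fastforce
    show "z \<in> chain_cells n ?K m \<longleftrightarrow> z \<in> corner (cells \<partial>\<Delta>[n]) n m"
    proof (cases "\<sigma> \<in> ord_maps m 3 \<and> \<tau> \<in> ord_maps m n")
      case True
      then have "z \<in> chain_cells n ?K m \<longleftrightarrow>
          \<not> (\<tau> ` {..m} = {..n} \<and> e + 1 \<in> \<sigma> ` {..m} \<and> q \<in> \<sigma> ` {..m})"
        using image_in_grid_chains[of \<sigma> m \<tau> n]
        by (simp add: z chain_cells_def essential_def image_image)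
      also have "\<tau> ` {..m} = {..n} \<longleftrightarrow> (\<forall>l\<in>{..n}. l \<in> \<tau> ` {..m})"
        using True ord_maps_image[of \<tau> m n] by blast
      also have "\<not> ((\<forall>l\<in>{..n}. l \<in> \<tau> ` {..m}) \<and> e + 1 \<in> \<sigma> ` {..m} \<and> q \<in> \<sigma> ` {..m}) \<longleftrightarrow>
          z \<in> corner (cells \<partial>\<Delta>[n]) n m"
        using True unfolding z corner_def cells_segal_horn rows simplex_boundary_def cells_faces_union
        by (simp only: mem_Collect_eq prod.case std_simplex_simps) blast
      finally show ?thesis .
    next
      case False
      then show ?thesis unfolding z chain_cells_def corner_def by auto
    qed
  qed
  moreover have "extendable X (sset_prod \<Delta>[3] \<Delta>[n]) (chain_cells n ?K) (cells (sset_prod \<Delta>[3] \<Delta>[n]))"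
  proof (rule extendable_chain_cells[OF X horns])
    show "down_closed ?K"
      unfolding down_closed_def
    proof (intro conjI ballI allI impI)
      show "{} \<notin> ?K" by (simp add: grid_chains_def)
      fix S T assume S: "S \<in> ?K" and T: "T \<subseteq> S" "T \<noteq> {}"
      then have "T \<in> grid_chains n" using grid_chains_subset by blast
      moreover have "snd ` S \<subseteq> {..n}" using S by (auto simp: grid_chains_def)
      moreover have "snd ` T \<subseteq> snd ` S" "fst ` T \<subseteq> fst ` S" using T(1) by auto
      ultimately show "T \<in> ?K" using S unfolding essential_def by blast
    qed
  qed auto
  ultimately show ?thesis by simp
qed

end

theorem corollary5p6:
  fixes X :: "'a sset"
  assumes "simplicial_set X"
  shows "quasi_2_segal X \<longleftrightarrow>
    trivial_fibration (map_sset \<Delta>[3] X) (map_sset \<Lambda>\<^sup>2[0,2;3] X)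
      (map_precomp \<Lambda>\<^sup>2[0,2;3] \<Delta>[3] X (sset_incl \<Lambda>\<^sup>2[0,2;3])) \<and>
    trivial_fibration (map_sset \<Delta>[3] X) (map_sset \<Lambda>\<^sup>2[1,3;3] X)
      (map_precomp \<Lambda>\<^sup>2[1,3;3] \<Delta>[3] X (sset_incl \<Lambda>\<^sup>2[1,3;3]))"
  unfolding quasi_2_segal_iff_extendable[OF assms] trivial_fibration_iff_extendable[OF assms]
proof (intro iffI conjI allI impI)
  assume "\<forall>n\<ge>3. \<forall>i j. i \<noteq> j \<and> broken n {i, j} \<longrightarrow>
    extendable X \<Delta>[n] (cells \<Lambda>\<^sup>2[i,j;n]) (cells \<Delta>[n])"
  then have horns: "extendable X \<Delta>[k] (cells \<Lambda>\<^sup>2[i,j;k]) (cells \<Delta>[k])"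
    if "i \<noteq> j" "broken k {i, j}" for k i j
    using that by (auto simp: broken_def)
  \<comment> \<open>The two shapes give the corners for \<open>\<Lambda>\<^sup>2[0,2;3]\<close> and
    \<open>\<Lambda>\<^sup>2[1,3;3]\<close>, in this order.\<close>
  have "horn_shape 0 3" "horn_shape 1 0" by (simp_all add: horn_shape_def)
  note corner = this[THEN horn_shape.extendable_corner_boundary, OF assms horns]
  fix n
  show "extendable X (sset_prod \<Delta>[3] \<Delta>[n])
      (pushout_corner.corner \<Delta>[3] (cells \<Lambda>\<^sup>2[0,2;3]) (cells \<partial>\<Delta>[n]) n) (cells (sset_prod \<Delta>[3] \<Delta>[n]))"
    using corner(1)[of n] by (simp add: numeral_2_eq_2)
  show "extendable X (sset_prod \<Delta>[3] \<Delta>[n])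
      (pushout_corner.corner \<Delta>[3] (cells \<Lambda>\<^sup>2[1,3;3]) (cells \<partial>\<Delta>[n]) n) (cells (sset_prod \<Delta>[3] \<Delta>[n]))"
    using corner(2)[of n] by (simp add: numeral_3_eq_3)
next
  assume *: "(\<forall>n. extendable X (sset_prod \<Delta>[3] \<Delta>[n])
      (pushout_corner.corner \<Delta>[3] (cells \<Lambda>\<^sup>2[0,2;3]) (cells \<partial>\<Delta>[n]) n) (cells (sset_prod \<Delta>[3] \<Delta>[n]))) \<and>
    (\<forall>n. extendable X (sset_prod \<Delta>[3] \<Delta>[n])
      (pushout_corner.corner \<Delta>[3] (cells \<Lambda>\<^sup>2[1,3;3]) (cells \<partial>\<Delta>[n]) n) (cells (sset_prod \<Delta>[3] \<Delta>[n])))"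
  fix n i j :: nat
  assume ij: "i \<noteq> j \<and> broken n {i, j}"
  show "extendable X \<Delta>[n] (cells \<Lambda>\<^sup>2[i,j;n]) (cells \<Delta>[n])"
  \<comment> \<open>The horn is symmetric in its two indices, so the smaller one may be put
    first.\<close>
  proof (cases "i < j")
    case True
    then show ?thesis
      using extendable_segal_horn[OF assms _ _ broken_pairD] * ij by blast
  next
    case False
    then have "j < i" "broken n {j, i}" using ij by (auto simp: insert_commute)
    then show ?thesis
      using extendable_segal_horn[OF assms _ _ broken_pairD] * segal_horn_commute[of i j n] by metis
  qed
qed

end
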